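(* Let $p$ be a prime, $\Bbbk$ a field of characteristic $p$, $G$ a finite $p$-group, and $V_1,V_2$ finite-dimensional $\Bbbk G$-modules. For $j=1,2$ choose a basis $x_{1,j},\ldots,x_{n_j,j},y_{1,j},\ldots,y_{m_j,j}$ of $V_j^*$ such that $x_{1,j},\ldots,x_{n_j,j}$ are fixed by $G$. Assume that the Hilbert ideals $\mathcal{H}_1=\Bbbk[V_1]^G_+\Bbbk[V_1]$ and $\mathcal{H}_2=\Bbbk[V_2]^G_+\Bbbk[V_2]$ are generated by sets $S_1$ and $S_2$ consisting of powers of the basis variables $x_{1,1},\ldots,x_{n_1,1},y_{1,1},\ldots,y_{m_1,1}$ of $V_1^*$ and $x_{1,2},\ldots,x_{n_2,2},y_{1,2},\ldots,y_{m_2,2}$ of $V_2^*$, respectively, and that the variables $y_{1,1},\ldots,y_{m_1,1},y_{1,2},\ldots,y_{m_2,2}$ are terminal variables. Then the Hilbert ideal $\mathcal{H}=\Bbbk[V_1\oplus V_2]^G_+\Bbbk[V_1\oplus V_2]$ is generated by $S_1\cup S_2$.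
   Context: For a $\Bbbk G$-module $W$, $\Bbbk[W]=S(W^* )$ with $G$ acting by $\sigma(f)=f\circ\sigma^{-1}$; $\Bbbk[W]^G$ is the ring of invariants and $\Bbbk[W]^G_+\Bbbk[W]$, the Hilbert ideal, is the ideal of $\Bbbk[W]$ generated by homogeneous invariants of positive degree. The rings $\Bbbk[V_1]$ and $\Bbbk[V_2]$ are regarded as subrings of $\Bbbk[V_1\oplus V_2]$, which is the polynomial ring in all variables $x_{i,j},y_{i,j}$. Given a basis of $W^*$, a basis element is a terminal variable if the $\Bbbk$-span of the other basis elements is a $\Bbbk G$-submodule of $W^*$. (A basis element that is terminal in $V_j^*$ is also terminal in $V_1^*\oplus V_2^*$ with respect to the union of the two bases.) *)

theory Defs
  imports
    "HOL-Algebra.Group_Action"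
    "HOL-Algebra.Ideal"
    "HOL-Analysis.Product_Vector"
    "HOL-Library.Function_Algebras"
    "HOL-Library.Poly_Mapping"
    "HOL-Computational_Algebra.Primes"
begin

section \<open>Modules over a group algebra and their duals\<close>

locale kG_module =
  group_action G UNIV act + vector_space smul
  for G :: "('g, 'z) monoid_scheme" (structure)
    and smul :: "'k::field \<Rightarrow> 'v::ab_group_add \<Rightarrow> 'v"
    and act :: "'g \<Rightarrow> 'v \<Rightarrow> 'v" +
  assumes linear_act: "\<sigma> \<in> carrier G \<Longrightarrow> Vector_Spaces.linear smul smul (act \<sigma>)"
    and finite_dimensional: "\<exists>B. finite_dimensional_vector_space smul B"

text \<open>
  The functions from V to the ground field form a vector space under the pointwise operations;
  the dual space is a subspace of it, and spans and independence of functionals are taken there.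
\<close>

definition dual_scale :: "'k::field \<Rightarrow> ('v \<Rightarrow> 'k) \<Rightarrow> 'v \<Rightarrow> 'k" where
  "dual_scale c f = (\<lambda>v. c * f v)"

interpretation dual: vector_space "dual_scale :: 'k::field \<Rightarrow> ('v \<Rightarrow> 'k) \<Rightarrow> 'v \<Rightarrow> 'k"
  by unfold_locales (auto simp: dual_scale_def fun_eq_iff algebra_simps)

definition dual_space :: "('k::field \<Rightarrow> 'v::ab_group_add \<Rightarrow> 'v) \<Rightarrow> ('v \<Rightarrow> 'k) set" where
  "dual_space smul = {f. Vector_Spaces.linear smul (*) f}"

lemma dual_space_iff:
  assumes "vector_space smul"
  shows "f \<in> dual_space smul \<longleftrightarrow>
    (\<forall>x y. f (x + y) = f x + f y) \<and> (\<forall>c x. f (smul c x) = c * f x)"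
proof -
  interpret vector_space smul by fact
  interpret K: vector_space "(*) :: 'a \<Rightarrow> 'a \<Rightarrow> 'a"
    by unfold_locales (auto simp: algebra_simps)
  show ?thesis
    unfolding dual_space_def mem_Collect_eq Vector_Spaces.linear_def module_hom_iff
    by (simp add: vector_space_axioms K.vector_space_axioms module_axioms K.module_axioms)
qed

definition dual_act ::
    "('g, 'z) monoid_scheme \<Rightarrow> ('g \<Rightarrow> 'v \<Rightarrow> 'v) \<Rightarrow> 'g \<Rightarrow> ('v \<Rightarrow> 'k) \<Rightarrow> 'v \<Rightarrow> 'k" where
  "dual_act G act \<sigma> f = f \<circ> act (inv\<^bsub>G\<^esub> \<sigma>)"

definition dual_submodule ::
    "('g, 'z) monoid_scheme \<Rightarrow> ('k::field \<Rightarrow> 'v::ab_group_add \<Rightarrow> 'v) \<Rightarrow> ('g \<Rightarrow> 'v \<Rightarrow> 'v) \<Rightarrow>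
      ('v \<Rightarrow> 'k) set \<Rightarrow> bool" where
  "dual_submodule G smul act U \<longleftrightarrow>
     U \<subseteq> dual_space smul \<and> dual.subspace U \<and> (\<forall>\<sigma>\<in>carrier G. dual_act G act \<sigma> ` U \<subseteq> U)"

text \<open>Bases of the dual are families, indexed by a set \<open>A\<close>.\<close>

definition dual_basis ::
    "('k::field \<Rightarrow> 'v::ab_group_add \<Rightarrow> 'v) \<Rightarrow> 'i set \<Rightarrow> ('i \<Rightarrow> 'v \<Rightarrow> 'k) \<Rightarrow> bool" where
  "dual_basis smul A b \<longleftrightarrow>
     finite A \<and> inj_on b A \<and> dual.independent (b ` A) \<and> dual.span (b ` A) = dual_space smul"

lemma dual_basis_iff_family:
  fixes b :: "'i \<Rightarrow> 'v \<Rightarrow> 'k::field"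
  assumes "finite A"
  shows "inj_on b A \<and> dual.independent (b ` A) \<longleftrightarrow>
    (\<forall>c. (\<Sum>i\<in>A. dual_scale (c i) (b i)) = 0 \<longrightarrow> (\<forall>i\<in>A. c i = 0))" (is "?L \<longleftrightarrow> ?R")
proof
  assume L: ?L
  show ?R
  proof (intro allI impI ballI)
    fix c i assume c: "(\<Sum>i\<in>A. dual_scale (c i) (b i)) = 0" and i: "i \<in> A"
    have "(\<Sum>x\<in>b ` A. dual_scale (c (the_inv_into A b x)) x) = 0"
      using L c by (simp add: sum.reindex the_inv_into_f_f cong: sum.cong)
    then have "c (the_inv_into A b (b i)) = 0"
      using L dual.independentD[of "b ` A" "b ` A" "\<lambda>x. c (the_inv_into A b x)" "b i"] assms i by auto
    then show "c i = 0" using L i by (simp add: the_inv_into_f_f)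
  qed
next
  assume R: ?R
  have inj: "inj_on b A"
  proof (rule inj_onI, rule ccontr)
    fix i j assume ij: "i \<in> A" "j \<in> A" "b i = b j" "i \<noteq> j"
    define c where "c = (\<lambda>k. if k = i then 1 else if k = j then -1 else 0 :: 'k)"
    have "(\<Sum>k\<in>A. dual_scale (c k) (b k)) = (\<Sum>k\<in>{i,j}. dual_scale (c k) (b k))"
      using ij assms by (intro sum.mono_neutral_right) (auto simp: c_def)
    also have "\<dots> = 0" using ij by (simp add: c_def)
    finally have "c i = 0" using R ij(1) by blast
    then show False by (simp add: c_def)
  qed
  moreover have "dual.independent (b ` A)"
  proof (subst dual.dependent_finite)
    show "finite (b ` A)" using assms by simp
    show "\<not> (\<exists>u. (\<exists>v\<in>b ` A. u v \<noteq> 0) \<and> (\<Sum>v\<in>b ` A. dual_scale (u v) v) = 0)"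
      using R inj by (auto simp: sum.reindex)
  qed
  ultimately show ?L by blast
qed

definition terminal_variable ::
    "('g, 'z) monoid_scheme \<Rightarrow> ('k::field \<Rightarrow> 'v::ab_group_add \<Rightarrow> 'v) \<Rightarrow> ('g \<Rightarrow> 'v \<Rightarrow> 'v) \<Rightarrow>
      'i set \<Rightarrow> ('i \<Rightarrow> 'v \<Rightarrow> 'k) \<Rightarrow> 'i \<Rightarrow> bool" where
  "terminal_variable G smul act A b i \<longleftrightarrow>
     i \<in> A \<and> dual_submodule G smul act (dual.span (b ` (A - {i})))"


section \<open>Polynomial rings, invariants and Hilbert ideals\<close>

text \<open>
  If \<open>b\<close> is a basis of the dual of W indexed by \<open>A\<close>, then k[W], the symmetric algebra of that
  dual, is the polynomial ring in variables indexed by \<open>A\<close>, the variable with index \<open>i\<close> standing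
  for the functional \<open>b i\<close>. Polynomials are finitely supported functions on monomials. All
  polynomials over an index type \<open>'i\<close> share one type, so that enlarging \<open>A\<close> literally
  enlarges the ring.
\<close>

type_synonym ('i, 'k) mpoly = "('i \<Rightarrow>\<^sub>0 nat) \<Rightarrow>\<^sub>0 'k"

definition Const :: "'k::field \<Rightarrow> ('i, 'k) mpoly" where
  "Const c = Poly_Mapping.single 0 c"

definition Var :: "'i \<Rightarrow> ('i, 'k::field) mpoly" where
  "Var i = Poly_Mapping.single (Poly_Mapping.single i 1) 1"

definition poly_ring :: "'i set \<Rightarrow> ('i, 'k::field) mpoly ring" where
  "poly_ring A =
     \<lparr>carrier = {f. \<forall>m\<in>Poly_Mapping.keys f. Poly_Mapping.keys m \<subseteq> A},
      monoid.mult = (*), one = 1, zero = 0, add = (+)\<rparr>"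

lemma keys_add_subset:
  "Poly_Mapping.keys (m + m') = Poly_Mapping.keys m \<union> Poly_Mapping.keys (m' :: 'i \<Rightarrow>\<^sub>0 nat)"
  by (auto simp: in_keys_iff lookup_add)

lemma poly_ring_cring: "cring (poly_ring A :: ('i, 'k::field) mpoly ring)"
proof -
  let ?R = "poly_ring A :: ('i, 'k) mpoly ring"
  have mult: "f * g \<in> carrier ?R"
    if "f \<in> carrier ?R" "g \<in> carrier ?R" for f g :: "('i, 'k) mpoly"
    unfolding poly_ring_def partial_object.simps mem_Collect_eq
  proof
    fix m assume "m \<in> Poly_Mapping.keys (f * g)"
    then obtain a b where "m = a + b" "a \<in> Poly_Mapping.keys f" "b \<in> Poly_Mapping.keys g"
      using Poly_Mapping.keys_mult[of f g] by blast
    then show "Poly_Mapping.keys m \<subseteq> A"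
      using that by (simp add: poly_ring_def keys_add_subset)
  qed
  have add: "f + g \<in> carrier ?R"
    if "f \<in> carrier ?R" "g \<in> carrier ?R" for f g :: "('i, 'k) mpoly"
    using that Poly_Mapping.keys_add[of f g] by (fastforce simp: poly_ring_def)
  have neg: "- f \<in> carrier ?R"
    if "f \<in> carrier ?R" for f :: "('i, 'k) mpoly"
    using that by (simp add: poly_ring_def)
  have ops: "monoid.mult ?R = (*)" "one ?R = 1" "zero ?R = 0"
    "add ?R = (+)" "1 \<in> carrier ?R" "0 \<in> carrier ?R"
    by (simp_all add: poly_ring_def)
  show ?thesis
  proof (intro cringI abelian_groupI comm_monoidI; unfold ops)
    fix f :: "('i, 'k) mpoly" assume "f \<in> carrier ?R"
    then show "\<exists>g\<in>carrier ?R. g + f = 0" by (intro bexI[of _ "- f"]) (simp_all add: neg)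
  qed (simp_all add: mult add ops(5,6) algebra_simps)
qed

definition homogeneous :: "nat \<Rightarrow> ('i, 'k::field) mpoly \<Rightarrow> bool" where
  "homogeneous d f \<longleftrightarrow>
     (\<forall>m\<in>Poly_Mapping.keys f. (\<Sum>i\<in>Poly_Mapping.keys m. Poly_Mapping.lookup m i) = d)"

definition subst :: "('i \<Rightarrow> ('i, 'k::field) mpoly) \<Rightarrow> ('i, 'k) mpoly \<Rightarrow> ('i, 'k) mpoly" where
  "subst h f =
     (\<Sum>m\<in>Poly_Mapping.keys f. Const (Poly_Mapping.lookup f m) *
        (\<Prod>i\<in>Poly_Mapping.keys m. h i ^ Poly_Mapping.lookup m i))"

text \<open>The linear polynomial that represents a functional in the span of the basis.\<close>

definition linear_form :: "'i set \<Rightarrow> ('i \<Rightarrow> 'v \<Rightarrow> 'k::field) \<Rightarrow> ('v \<Rightarrow> 'k) \<Rightarrow> ('i, 'k) mpoly" where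
  "linear_form A b l = (\<Sum>i\<in>A. Const (dual.representation (b ` A) l (b i)) * Var i)"

text \<open>The extension of the action on the dual to algebra automorphisms of the polynomial ring.\<close>

definition poly_act ::
    "('g, 'z) monoid_scheme \<Rightarrow> ('g \<Rightarrow> 'v \<Rightarrow> 'v) \<Rightarrow> 'i set \<Rightarrow> ('i \<Rightarrow> 'v \<Rightarrow> 'k::field) \<Rightarrow> 'g \<Rightarrow>
      ('i, 'k) mpoly \<Rightarrow> ('i, 'k) mpoly" where
  "poly_act G act A b \<sigma> = subst (\<lambda>i. linear_form A b (dual_act G act \<sigma> (b i)))"

definition invariant_polys ::
    "('g, 'z) monoid_scheme \<Rightarrow> ('g \<Rightarrow> 'v \<Rightarrow> 'v) \<Rightarrow> 'i set \<Rightarrow> ('i \<Rightarrow> 'v \<Rightarrow> 'k::field) \<Rightarrow>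
      ('i, 'k) mpoly set" where
  "invariant_polys G act A b =
     {f \<in> carrier (poly_ring A). \<forall>\<sigma>\<in>carrier G. poly_act G act A b \<sigma> f = f}"

definition hilbert_ideal ::
    "('g, 'z) monoid_scheme \<Rightarrow> ('g \<Rightarrow> 'v \<Rightarrow> 'v) \<Rightarrow> 'i set \<Rightarrow> ('i \<Rightarrow> 'v \<Rightarrow> 'k::field) \<Rightarrow>
      ('i, 'k) mpoly set" where
  "hilbert_ideal G act A b =
     Idl\<^bsub>poly_ring A\<^esub> {f \<in> invariant_polys G act A b. \<exists>d>0. homogeneous d f}"


section \<open>Direct sums\<close>

text \<open>
  The direct sum of V and W is the product type, with scalar multiplication
  \<open>module_prod.scale\<close>. Functionals on the summands extend by zero, and the union of the two
  bases is indexed by the union of the (disjoint) index sets.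
\<close>

definition sum_act ::
    "('g \<Rightarrow> 'v \<Rightarrow> 'v) \<Rightarrow> ('g \<Rightarrow> 'w \<Rightarrow> 'w) \<Rightarrow> 'g \<Rightarrow> 'v \<times> 'w \<Rightarrow> 'v \<times> 'w" where
  "sum_act act1 act2 \<sigma> = map_prod (act1 \<sigma>) (act2 \<sigma>)"

definition sum_basis ::
    "'i set \<Rightarrow> ('i \<Rightarrow> 'v \<Rightarrow> 'k) \<Rightarrow> ('i \<Rightarrow> 'w \<Rightarrow> 'k) \<Rightarrow> 'i \<Rightarrow> 'v \<times> 'w \<Rightarrow> 'k" where
  "sum_basis A1 b1 b2 i = (if i \<in> A1 then b1 i \<circ> fst else b2 i \<circ> snd)"

lemma kG_module_sum:
  fixes smul1 :: "'k::field \<Rightarrow> 'b::ab_group_add \<Rightarrow> 'b"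
    and smul2 :: "'k \<Rightarrow> 'd::ab_group_add \<Rightarrow> 'd"
  assumes "kG_module G smul1 act1" "kG_module G smul2 act2"
  shows "kG_module G (module_prod.scale smul1 smul2) (sum_act act1 act2)"
proof -
  interpret M1: kG_module G smul1 act1 by fact
  interpret M2: kG_module G smul2 act2 by fact
  interpret P: vector_space_prod smul1 smul2 ..
  have bij: "sum_act act1 act2 \<sigma> \<in> Bij UNIV" if "\<sigma> \<in> carrier G" for \<sigma>
    using M1.bij_prop0[OF that] M2.bij_prop0[OF that]
    by (simp add: Bij_def sum_act_def bij_betw_def map_prod_surj prod.inj_map)
  show ?thesis
  proof (intro kG_module.intro kG_module_axioms.intro group_action.intro group_hom.intro group_hom_axioms.intro)
    show "group G" by (rule group_hom.axioms(1)[OF M1.group_hom])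
  next
    show "group (BijGroup (UNIV :: ('b \<times> 'd) set))" by (rule group_BijGroup)
  next
    show "vector_space P.scale" ..
  next
    show "sum_act act1 act2 \<in> hom G (BijGroup UNIV)"
      unfolding hom_def
      using bij M1.composition_rule M2.composition_rule
      by (auto simp: BijGroup_def compose_def sum_act_def fun_eq_iff group.is_monoid monoid.m_closed[OF group.is_monoid[OF group_hom.axioms(1)[OF M1.group_hom]]])
  next
    fix \<sigma> assume s: "\<sigma> \<in> carrier G"
    interpret l1: Vector_Spaces.linear smul1 smul1 "act1 \<sigma>" by (rule M1.linear_act[OF s])
    interpret l2: Vector_Spaces.linear smul2 smul2 "act2 \<sigma>" by (rule M2.linear_act[OF s])
    show "Vector_Spaces.linear P.scale P.scale (sum_act act1 act2 \<sigma>)"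
      by unfold_locales (auto simp: sum_act_def P.scale_def l1.add l2.add l1.scale l2.scale)
  next
    obtain B1 B2 where "finite_dimensional_vector_space smul1 B1" "finite_dimensional_vector_space smul2 B2"
      using M1.finite_dimensional M2.finite_dimensional by blast
    then interpret F: finite_dimensional_vector_space_prod smul1 smul2 B1 B2
      by (simp add: finite_dimensional_vector_space_prod_def finite_dimensional_vector_space_pair_def
        vector_space_prod_def P.vector_space_pair_axioms)
    show "\<exists>B. finite_dimensional_vector_space P.scale B"
      using F.p.finite_dimensional_vector_space_axioms by blast
  qed
qed

lemma dual_basis_sum:
  fixes smul1 :: "'k::field \<Rightarrow> 'v::ab_group_add \<Rightarrow> 'v"
    and smul2 :: "'k \<Rightarrow> 'w::ab_group_add \<Rightarrow> 'w"
    and b1 :: "'i \<Rightarrow> 'v \<Rightarrow> 'k"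
  assumes "kG_module G smul1 act1" "kG_module G smul2 act2"
    and B1: "dual_basis smul1 A1 b1" and B2: "dual_basis smul2 A2 b2" and disj: "A1 \<inter> A2 = {}"
  shows "dual_basis (module_prod.scale smul1 smul2) (A1 \<union> A2) (sum_basis A1 b1 b2)"
proof -
  interpret M1: kG_module G smul1 act1 by fact
  interpret M2: kG_module G smul2 act2 by fact
  interpret P: vector_space_prod smul1 smul2 ..
  have fin: "finite A1" "finite A2" using B1 B2 by (auto simp: dual_basis_def)
  let ?b = "sum_basis A1 b1 b2"
  note dual_iff1 = dual_space_iff[OF M1.vector_space_axioms]
    and dual_iff2 = dual_space_iff[OF M2.vector_space_axioms]
    and dual_iff = dual_space_iff[OF P.p.vector_space_axioms]
  have lin1: "b1 i \<in> dual_space smul1" if "i \<in> A1" for i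
    using B1 that dual.span_base[of "b1 i" "b1 ` A1"] by (auto simp: dual_basis_def)
  have lin2: "b2 i \<in> dual_space smul2" if "i \<in> A2" for i
    using B2 that dual.span_base[of "b2 i" "b2 ` A2"] by (auto simp: dual_basis_def)
  have z1: "b1 i 0 = 0" if "i \<in> A1" for i
    using lin1[OF that] unfolding dual_iff1 by (metis add_cancel_right_right add_0_right)
  have z2: "b2 i 0 = 0" if "i \<in> A2" for i
    using lin2[OF that] unfolding dual_iff2 by (metis add_cancel_right_right add_0_right)
  have sum_app: "(\<Sum>i\<in>A. f i) x = (\<Sum>i\<in>A. f i x)" for A and f :: "'j \<Rightarrow> 'x \<Rightarrow> 'k" and x
    by (induction A rule: infinite_finite_induct) auto
  have "inj_on ?b (A1 \<union> A2) \<and> dual.independent (?b ` (A1 \<union> A2))"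
  proof (subst dual_basis_iff_family[OF finite_UnI[OF fin]])
    show "\<forall>c. (\<Sum>i\<in>A1 \<union> A2. dual_scale (c i) (?b i)) = 0 \<longrightarrow> (\<forall>i\<in>A1 \<union> A2. c i = 0)"
    proof (intro allI impI)
      fix c assume c: "(\<Sum>i\<in>A1 \<union> A2. dual_scale (c i) (?b i)) = 0"
      have *: "(\<Sum>i\<in>A1. c i * b1 i v) + (\<Sum>i\<in>A2. c i * b2 i w) = 0" for v w
      proof -
        have "(\<Sum>i\<in>A1 \<union> A2. c i * ?b i (v, w)) = 0"
          using fun_cong[OF c, of "(v, w)"] by (simp add: sum_app dual_scale_def)
        also have "(\<Sum>i\<in>A1 \<union> A2. c i * ?b i (v, w)) =
            (\<Sum>i\<in>A1. c i * ?b i (v, w)) + (\<Sum>i\<in>A2. c i * ?b i (v, w))"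
          by (rule sum.union_disjoint[OF fin disj])
        also have "(\<Sum>i\<in>A1. c i * ?b i (v, w)) = (\<Sum>i\<in>A1. c i * b1 i v)"
          by (simp add: sum_basis_def)
        also have "(\<Sum>i\<in>A2. c i * ?b i (v, w)) = (\<Sum>i\<in>A2. c i * b2 i w)"
          using disj by (intro sum.cong) (auto simp: sum_basis_def)
        finally show ?thesis .
      qed
      have "(\<Sum>i\<in>A1. dual_scale (c i) (b1 i)) = 0"
        using *[of _ 0] z2 by (simp add: fun_eq_iff sum_app dual_scale_def)
      moreover have "(\<Sum>i\<in>A2. dual_scale (c i) (b2 i)) = 0"
        using *[of 0] z1 by (simp add: fun_eq_iff sum_app dual_scale_def)
      ultimately show "\<forall>i\<in>A1 \<union> A2. c i = 0"
        using dual_basis_iff_family[OF fin(1), of b1] dual_basis_iff_family[OF fin(2), of b2] B1 B2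
        unfolding dual_basis_def by blast
    qed
  qed
  moreover have "dual.span (?b ` (A1 \<union> A2)) = dual_space P.scale"
  proof
    have "?b i \<in> dual_space P.scale" if "i \<in> A1 \<union> A2" for i
      using lin1[of i] lin2[of i] that unfolding dual_iff dual_iff1 dual_iff2
      by (auto simp: sum_basis_def P.scale_def)
    moreover have "dual.subspace (dual_space P.scale)"
      unfolding dual.subspace_def Ball_def dual_iff by (simp add: dual_scale_def algebra_simps)
    ultimately show "dual.span (?b ` (A1 \<union> A2)) \<subseteq> dual_space P.scale"
      by (intro dual.span_minimal) auto
  next
    show "dual_space P.scale \<subseteq> dual.span (?b ` (A1 \<union> A2))"
    proof
      fix l assume "l \<in> dual_space P.scale"
      then have l: "\<And>x y. l (x + y) = l x + l y" "\<And>c x. l (P.scale c x) = c * l x"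
        unfolding dual_iff by blast+
      define l1 where "l1 = (\<lambda>v. l (v, 0))"
      define l2 where "l2 = (\<lambda>w. l (0, w))"
      have "l1 \<in> dual_space smul1"
        using l(1)[of "(_, 0)" "(_, 0)"] l(2)[of _ "(_, 0)"]
        by (simp add: dual_iff1 l1_def P.scale_def)
      then have 1: "l1 \<in> dual.span (b1 ` A1)" using B1 by (simp add: dual_basis_def)
      have "l2 \<in> dual_space smul2"
        using l(1)[of "(0, _)" "(0, _)"] l(2)[of _ "(0, _)"]
        by (simp add: dual_iff2 l2_def P.scale_def)
      then have 2: "l2 \<in> dual.span (b2 ` A2)" using B2 by (simp add: dual_basis_def)
      have pull: "f \<circ> g \<in> dual.span ((\<lambda>f. f \<circ> g) ` B)" if "f \<in> dual.span B"
        for f :: "'x \<Rightarrow> 'k" and g :: "'v \<times> 'w \<Rightarrow> 'x" and B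
      proof -
        have "Vector_Spaces.linear dual_scale dual_scale (\<lambda>f :: 'x \<Rightarrow> 'k. f \<circ> g)"
          by unfold_locales (simp_all add: dual_scale_def fun_eq_iff algebra_simps)
        then show ?thesis
          using that module_hom.span_image[OF Vector_Spaces.linear.axioms(3)] by blast
      qed
      have "(\<lambda>f. f \<circ> fst) ` b1 ` A1 \<subseteq> ?b ` (A1 \<union> A2)"
        by (auto simp: sum_basis_def image_iff)
      moreover have "(\<lambda>f. f \<circ> snd) ` b2 ` A2 \<subseteq> ?b ` (A1 \<union> A2)"
        using disj by (auto simp: sum_basis_def image_iff intro!: bexI)
      ultimately have "(l1 \<circ> fst) + (l2 \<circ> snd) \<in> dual.span (?b ` (A1 \<union> A2))"
        using pull[OF 1, of fst] pull[OF 2, of snd]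
        by (intro dual.span_add) (meson dual.span_mono subsetD)+
      moreover have "(l1 \<circ> fst) + (l2 \<circ> snd) = l"
        by (simp add: fun_eq_iff l1_def l2_def flip: l(1))
      ultimately show "l \<in> dual.span (?b ` (A1 \<union> A2))" by simp
    qed
  qed
  ultimately show ?thesis using fin by (simp add: dual_basis_def)
qed

text \<open>\<open>X i j\<close> and \<open>Y i j\<close> index the i-th x-variable and the i-th y-variable of the j-th module.\<close>

datatype var_index = X nat nat | Y nat nat

definition x_indices :: "nat \<Rightarrow> nat \<Rightarrow> var_index set" where
  "x_indices n j = (\<lambda>i. X i j) ` {1..n}"

definition y_indices :: "nat \<Rightarrow> nat \<Rightarrow> var_index set" where
  "y_indices m j = (\<lambda>i. Y i j) ` {1..m}"

definition var_indices :: "nat \<Rightarrow> nat \<Rightarrow> nat \<Rightarrow> var_index set" where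
  "var_indices n m j = x_indices n j \<union> y_indices m j"

end

theory Submission
  imports Defs "HOL-Algebra.Multiplicative_Group"
begin

text \<open>
  Let \<open>f\<close> be a homogeneous invariant of positive degree on the sum and \<open>m\<close> a monomial of \<open>f\<close>.
  Since an ideal generated by powers of variables is a monomial ideal, it suffices that some
  element of \<open>S1 \<union> S2\<close> divides \<open>m\<close>. If an x-variable of the second module divides \<open>m\<close>, this
  holds because that variable is an invariant. Otherwise \<open>m = n q\<close> with \<open>n\<close> in the variables of the
  first module and \<open>q\<close> in the y-variables of the second. Terminality makes each \<open>\<sigma>\<close> fix these
  y-variables modulo the x-variables, so that the coefficient of \<open>q\<close> in \<open>f\<close> is an invariant on the
  first module. If \<open>n \<noteq> 1\<close>, this coefficient has positive degree and contains the monomial \<open>n\<close>,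
  which is therefore divisible by an element of \<open>S1\<close>. If \<open>n = 1\<close>, the restriction of \<open>f\<close> to the
  second module is an invariant that contains \<open>m\<close>, which is therefore divisible by an element of
  \<open>S2\<close>.
\<close>

abbreviation keys :: "('a \<Rightarrow>\<^sub>0 'b::zero) \<Rightarrow> 'a set" where
  "keys \<equiv> Poly_Mapping.keys"

abbreviation lookup :: "('a \<Rightarrow>\<^sub>0 'b::zero) \<Rightarrow> 'a \<Rightarrow> 'b" where
  "lookup \<equiv> Poly_Mapping.lookup"

section \<open>Polynomials supported on sets of monomials\<close>

lemma sum_singles:
  "(\<Sum>m\<in>keys f. Poly_Mapping.single m (lookup f m)) = (f :: 'a \<Rightarrow>\<^sub>0 'b::comm_monoid_add)"
proof (rule poly_mapping_eqI)
  fix k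
  show "lookup (\<Sum>m\<in>keys f. Poly_Mapping.single m (lookup f m)) k = lookup f k"
    by (simp add: lookup_sum lookup_single when_def in_keys_iff)
qed

text \<open>One notion serves three purposes: polynomial rings in fewer variables, ideals generated
  by powers of variables, and congruence modulo the ideal of a set of variables.\<close>

definition mono_span :: "('i \<Rightarrow>\<^sub>0 nat) set \<Rightarrow> ('i, 'k::field) mpoly set" where
  "mono_span U = {f. keys f \<subseteq> U}"

text \<open>Monomials are written additively, so this is closure under multiplication by arbitrary
  monomials, which is what makes \<open>mono_span U\<close> an ideal among all polynomials of the
  type.\<close>

definition upward :: "('i \<Rightarrow>\<^sub>0 nat) set \<Rightarrow> bool" where
  "upward U \<longleftrightarrow> (\<forall>m\<in>U. \<forall>n. m + n \<in> U)"

lemma carrier_poly_ring: "carrier (poly_ring A) = mono_span {m. keys m \<subseteq> A}"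
  by (auto simp: poly_ring_def mono_span_def)

lemma poly_ring_simps [simp]:
  "monoid.mult (poly_ring A) = (*)" "one (poly_ring A) = 1"
  "zero (poly_ring A) = 0" "add (poly_ring A) = (+)"
  by (simp_all add: poly_ring_def)

lemma mono_span_0: "0 \<in> mono_span U"
  by (simp add: mono_span_def)

lemma mono_span_add: "f \<in> mono_span U \<Longrightarrow> g \<in> mono_span U \<Longrightarrow> f + g \<in> mono_span U"
  using Poly_Mapping.keys_add[of f g] by (auto simp: mono_span_def)

lemma mono_span_sum: "(\<And>x. x \<in> I \<Longrightarrow> f x \<in> mono_span U) \<Longrightarrow> sum f I \<in> mono_span U"
  by (induction I rule: infinite_finite_induct) (auto simp: mono_span_0 mono_span_add)

lemma mono_span_mult:
  assumes "upward U" "f \<in> mono_span U" shows "f * g \<in> mono_span U"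
  using assms Poly_Mapping.keys_mult[of f g] by (fastforce simp: mono_span_def upward_def)

lemma mono_span_mult': "upward U \<Longrightarrow> f \<in> mono_span U \<Longrightarrow> g * f \<in> mono_span U"
  by (subst mult.commute) (rule mono_span_mult)

lemma mono_span_single: "m \<in> U \<Longrightarrow> Poly_Mapping.single m c \<in> mono_span U"
  by (simp add: mono_span_def)

text \<open>For upward \<open>U\<close> a difference in \<open>mono_span U\<close> is a congruence
  modulo an ideal, and congruences respect products. The induction exchanges one factor at a
  time.\<close>

lemma mono_span_power_cong:
  assumes "upward U" "f - g \<in> mono_span U" shows "f ^ n - g ^ n \<in> mono_span U"
proof (induction n)
  case (Suc n)
  have "f ^ Suc n - g ^ Suc n = f * (f ^ n - g ^ n) + (f - g) * g ^ n"
    by (simp add: algebra_simps)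
  then show ?case
    by (simp only:) (intro mono_span_add mono_span_mult mono_span_mult' assms Suc.IH)
qed (simp add: mono_span_0)

lemma mono_span_prod_cong:
  assumes "upward U" "\<And>i. i \<in> I \<Longrightarrow> f i - g i \<in> mono_span U"
  shows "prod f I - prod g I \<in> mono_span U"
  using assms(2)
proof (induction I rule: infinite_finite_induct)
  case (insert i I)
  have "prod f (insert i I) - prod g (insert i I) =
      f i * (prod f I - prod g I) + (f i - g i) * prod g I"
    using insert.hyps by (simp add: algebra_simps)
  also have "\<dots> \<in> mono_span U"
    by (intro mono_span_add mono_span_mult mono_span_mult' assms(1) insert) auto
  finally show ?case .
qed (simp_all add: mono_span_0)

section \<open>Closure properties of the polynomial ring in the variables of
  \<open>A\<close>\<close>

lemma carrier_closed:
  "f \<in> carrier (poly_ring A) \<Longrightarrow> g \<in> carrier (poly_ring A) \<Longrightarrow>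
    f * g \<in> carrier (poly_ring A)"
  "f \<in> carrier (poly_ring A) \<Longrightarrow> g \<in> carrier (poly_ring A) \<Longrightarrow>
    f + g \<in> carrier (poly_ring A)"
  "f \<in> carrier (poly_ring A) \<Longrightarrow> f ^ n \<in> carrier (poly_ring A)"
proof -
  interpret cring "poly_ring A :: ('a, 'b) mpoly ring" by (rule poly_ring_cring)
  show m: "f * g \<in> carrier (poly_ring A)"
    if "f \<in> carrier (poly_ring A)" "g \<in> carrier (poly_ring A)" for f g :: "('a, 'b) mpoly"
    using m_closed[OF that] by simp
  show "f + g \<in> carrier (poly_ring A)"
    if "f \<in> carrier (poly_ring A)" "g \<in> carrier (poly_ring A)"
    using a_closed[OF that] by simp
  show "f ^ n \<in> carrier (poly_ring A)" if "f \<in> carrier (poly_ring A)"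
    using one_closed by (induction n) (simp_all add: m that)
qed

lemma Const_carrier: "Const c \<in> carrier (poly_ring A)"
  by (simp add: Const_def carrier_poly_ring mono_span_def)

lemma Var_carrier: "i \<in> A \<Longrightarrow> Var i \<in> carrier (poly_ring A)"
  by (simp add: Var_def carrier_poly_ring mono_span_def)

lemma prod_carrier:
  "(\<And>i. i \<in> I \<Longrightarrow> f i \<in> carrier (poly_ring A)) \<Longrightarrow> prod f I \<in> carrier (poly_ring A)"
  using Const_carrier[of 1 A]
  by (induction I rule: infinite_finite_induct) (auto simp: carrier_closed Const_def)

lemma poly_ring_mono: "A \<subseteq> B \<Longrightarrow> carrier (poly_ring A) \<subseteq> carrier (poly_ring B)"
  by (auto simp: carrier_poly_ring mono_span_def)

lemma Var_power: "Var i ^ e = Poly_Mapping.single (Poly_Mapping.single i e) 1"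
proof (induction e)
  case (Suc e)
  show ?case
    by (simp add: Suc.IH) (simp add: Var_def mult_single flip: single_add)
qed simp

section \<open>Ideals of the polynomial ring\<close>

text \<open>Closure under negation is multiplication by the constant \<open>-1\<close>, which lies
  in \<open>poly_ring A\<close> for every \<open>A\<close>; the additive inverse of the ring
  structure is the negation of the type.\<close>

lemma poly_ring_idealI:
  fixes I :: "('i, 'k::field) mpoly set"
  assumes "I \<subseteq> carrier (poly_ring A)" "0 \<in> I"
    and add: "\<And>f g. f \<in> I \<Longrightarrow> g \<in> I \<Longrightarrow> f + g \<in> I"
    and mult: "\<And>f g. f \<in> I \<Longrightarrow> g \<in> carrier (poly_ring A) \<Longrightarrow> g * f \<in> I"
  shows "ideal I (poly_ring A)"
proof -
  interpret R: cring "poly_ring A :: ('i, 'k) mpoly ring" by (rule poly_ring_cring)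
  have neg: "\<ominus>\<^bsub>poly_ring A\<^esub> f = - f" if "f \<in> carrier (poly_ring A)" for f :: "('i, 'k) mpoly"
  proof -
    have "\<ominus>\<^bsub>poly_ring A\<^esub> f + f = 0" using R.l_neg[OF that] by simp
    then show ?thesis by (simp add: eq_neg_iff_add_eq_0)
  qed
  have negc: "- f \<in> I" if "f \<in> I" for f
    using mult[OF that, of "Const (-1)"] Const_carrier[of "-1" A]
    by (simp add: Const_def single_uminus)
  show ?thesis
  proof (rule idealI)
    show "subgroup I (add_monoid (poly_ring A))"
    proof (rule R.add.subgroupI)
      show "\<And>f. f \<in> I \<Longrightarrow> \<ominus>\<^bsub>poly_ring A\<^esub> f \<in> I"
        using neg negc assms(1) by (metis subsetD)
    qed (use assms in auto)
  qed (use R.ring_axioms mult in \<open>auto simp: mult.commute\<close>)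
qed

lemma ideal_poly_ringD:
  assumes "ideal I (poly_ring A)"
  shows "I \<subseteq> carrier (poly_ring A)" "0 \<in> I" "f \<in> I \<Longrightarrow> g \<in> I \<Longrightarrow> f + g \<in> I"
    "f \<in> I \<Longrightarrow> g \<in> carrier (poly_ring A) \<Longrightarrow> g * f \<in> I"
proof -
  interpret ideal I "poly_ring A" by fact
  show "I \<subseteq> carrier (poly_ring A)" by (rule a_subset)
  show "0 \<in> I" using additive_subgroup.zero_closed[OF is_additive_subgroup] by simp
  show "f \<in> I \<Longrightarrow> g \<in> I \<Longrightarrow> f + g \<in> I"
    using additive_subgroup.a_closed[OF is_additive_subgroup, of f g] by simp
  show "f \<in> I \<Longrightarrow> g \<in> carrier (poly_ring A) \<Longrightarrow> g * f \<in> I"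
    using I_l_closed[of f g] by simp
qed

lemma Idl_subset_poly_ring:
  fixes S :: "('i, 'k::field) mpoly set"
  assumes "ideal I (poly_ring A)" "S \<subseteq> I"
  shows "Idl\<^bsub>poly_ring A\<^esub> S \<subseteq> I"
  using assms by (intro ring.genideal_minimal cring.axioms(1)[OF poly_ring_cring])

lemma Idl_poly_ring:
  fixes S :: "('i, 'k::field) mpoly set"
  assumes "S \<subseteq> carrier (poly_ring A)"
  shows "ideal (Idl\<^bsub>poly_ring A\<^esub> S) (poly_ring A)" "S \<subseteq> Idl\<^bsub>poly_ring A\<^esub> S"
  using ring.genideal_ideal[OF cring.axioms(1)[OF poly_ring_cring] assms]
    ring.genideal_self[OF cring.axioms(1)[OF poly_ring_cring] assms] .

text \<open>The contraction to \<open>poly_ring A\<close> of the ideal generated by \<open>T\<close>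
  is an ideal that contains \<open>S\<close>.\<close>

lemma Idl_poly_ring_mono:
  fixes S T :: "('i, 'k::field) mpoly set"
  assumes "A \<subseteq> B" "S \<subseteq> T" "S \<subseteq> carrier (poly_ring A)" "T \<subseteq> carrier (poly_ring B)"
  shows "Idl\<^bsub>poly_ring A\<^esub> S \<subseteq> Idl\<^bsub>poly_ring B\<^esub> T"
proof -
  let ?I = "Idl\<^bsub>poly_ring B\<^esub> T"
  note D = ideal_poly_ringD[OF Idl_poly_ring(1)[OF assms(4)]]
  have "ideal (?I \<inter> carrier (poly_ring A)) (poly_ring A)"
    using D poly_ring_mono[OF assms(1)] Const_carrier[of 0 A]
    by (intro poly_ring_idealI) (auto simp: carrier_closed Const_def)
  moreover have "S \<subseteq> ?I \<inter> carrier (poly_ring A)"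
    using assms Idl_poly_ring(2)[OF assms(4)] by auto
  ultimately show ?thesis using Idl_subset_poly_ring by blast
qed

section \<open>Ideals generated by powers of variables\<close>

text \<open>These are the monomials divisible by a power of a variable in \<open>S\<close>. The
  exponent \<open>e = 0\<close> is allowed: if 1 belongs to \<open>S\<close>, every monomial is
  included.\<close>

definition power_multiples :: "('i, 'k::field) mpoly set \<Rightarrow> ('i \<Rightarrow>\<^sub>0 nat) set" where
  "power_multiples S = {m. \<exists>i e. Var i ^ e \<in> S \<and> e \<le> lookup m i}"

lemma upward_power_multiples: "upward (power_multiples S)"
  by (fastforce simp: upward_def power_multiples_def lookup_add)

text \<open>An ideal generated by monomials contains a polynomial exactly when it contains each of
  its monomials. The right side is an ideal containing \<open>S\<close>; conversely each of its
  monomials is a multiple of a generator, and the ideal is closed under sums.\<close>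

lemma Idl_powers:
  fixes S :: "('i, 'k::field) mpoly set"
  assumes S: "S \<subseteq> {Var i ^ e | i e. i \<in> A}"
  shows "Idl\<^bsub>poly_ring A\<^esub> S = carrier (poly_ring A) \<inter> mono_span (power_multiples S)"
proof
  have SA: "S \<subseteq> carrier (poly_ring A)"
    using S by (auto simp: carrier_closed Var_carrier)
  have "ideal (carrier (poly_ring A) \<inter> mono_span (power_multiples S)) (poly_ring A)"
    using Const_carrier[of 0 A]
    by (intro poly_ring_idealI)
      (auto simp: carrier_closed Const_def mono_span_0 mono_span_add
        mono_span_mult'[OF upward_power_multiples])
  moreover have "S \<subseteq> mono_span (power_multiples S)"
  proof
    fix s assume s: "s \<in> S"
    then obtain i e where ie: "s = Var i ^ e" using S by auto
    have "Poly_Mapping.single i e \<in> power_multiples S"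
      using s ie by (auto simp: power_multiples_def intro!: exI[of _ i] exI[of _ e])
    then show "s \<in> mono_span (power_multiples S)"
      by (simp add: ie Var_power mono_span_single)
  qed
  ultimately show "Idl\<^bsub>poly_ring A\<^esub> S \<subseteq> carrier (poly_ring A) \<inter> mono_span (power_multiples S)"
    using SA by (intro Idl_subset_poly_ring) auto
  note D = ideal_poly_ringD[OF Idl_poly_ring(1)[OF SA]]
  have single: "Poly_Mapping.single m c \<in> Idl\<^bsub>poly_ring A\<^esub> S"
    if m: "keys m \<subseteq> A" "m \<in> power_multiples S" for m c
  proof -
    obtain i e where ie: "Var i ^ e \<in> S" "e \<le> lookup m i"
      using m by (auto simp: power_multiples_def)
    \<comment> \<open>Subtraction of exponents is truncated at 0; it is exact here because
      \<open>e\<close> is at most the exponent of \<open>i\<close> in \<open>m\<close>.\<close>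
    have m': "(m - Poly_Mapping.single i e) + Poly_Mapping.single i e = m"
      using ie by (intro poly_mapping_eqI) (auto simp: lookup_add lookup_minus lookup_single when_def)
    have "Poly_Mapping.single (m - Poly_Mapping.single i e) c * Var i ^ e \<in> Idl\<^bsub>poly_ring A\<^esub> S"
    proof (rule D(4))
      show "Var i ^ e \<in> Idl\<^bsub>poly_ring A\<^esub> S" using ie Idl_poly_ring(2)[OF SA] by auto
      have "keys (m - Poly_Mapping.single i e) \<subseteq> keys m"
        by (auto simp: in_keys_iff lookup_minus)
      then show "Poly_Mapping.single (m - Poly_Mapping.single i e) c \<in> carrier (poly_ring A)"
        using m by (auto simp: carrier_poly_ring mono_span_def)
    qed
    then show ?thesis by (simp add: Var_power mult_single m')
  qed
  show "carrier (poly_ring A) \<inter> mono_span (power_multiples S) \<subseteq> Idl\<^bsub>poly_ring A\<^esub> S"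
  proof
    fix f :: "('i, 'k) mpoly"
    assume f: "f \<in> carrier (poly_ring A) \<inter> mono_span (power_multiples S)"
    \<comment> \<open>The induction runs over subsets of \<open>keys f\<close>, so that
      \<open>f\<close> and its coefficients stay fixed.\<close>
    have "(\<Sum>m\<in>K. Poly_Mapping.single m (lookup f m)) \<in> Idl\<^bsub>poly_ring A\<^esub> S"
      if "K \<subseteq> keys f" for K
      using finite_subset[OF that finite_keys] that
    proof (induction K rule: finite_induct)
      case (insert m K)
      then show ?case
        using f by (auto simp: carrier_poly_ring mono_span_def intro!: D(3) single)
    qed (use D in auto)
    from this[OF order_refl] show "f \<in> Idl\<^bsub>poly_ring A\<^esub> S" by (simp add: sum_singles)
  qed
qed


section \<open>Substitution and coefficients with respect to some of the variables\<close>

lemma Const_add: "Const (a + b) = Const a + Const b"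
  by (simp add: Const_def single_add)

lemma Const_0: "Const 0 = 0"
  by (simp add: Const_def)

text \<open>Additional monomials have coefficient 0. Two polynomials can thus be expanded over a
  common finite set, which gives additivity of substitution.\<close>

lemma subst_superset:
  assumes "finite K" "keys f \<subseteq> K"
  shows "subst h f = (\<Sum>m\<in>K. Const (lookup f m) * (\<Prod>i\<in>keys m. h i ^ lookup m i))"
  unfolding subst_def
  by (rule sum.mono_neutral_left) (use assms in \<open>auto simp: in_keys_iff Const_0\<close>)

lemma subst_add: "subst h (f + g) = subst h f + subst h g"
proof -
  let ?K = "keys f \<union> keys g"
  have "keys (f + g) \<subseteq> ?K" by (rule Poly_Mapping.keys_add)
  then have "subst h (f + g) =
      (\<Sum>m\<in>?K. Const (lookup f m + lookup g m) * (\<Prod>i\<in>keys m. h i ^ lookup m i))"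
    by (subst subst_superset[of ?K]) (simp_all add: lookup_add)
  also have "\<dots> = subst h f + subst h g"
    by (simp only: Const_add distrib_right sum.distrib
        subst_superset[of ?K f] subst_superset[of ?K g] finite_Un finite_keys Un_upper1 Un_upper2)
  finally show ?thesis .
qed

lemma subst_0 [simp]: "subst h 0 = 0"
  by (simp add: subst_def)

lemma subst_sum: "subst h (sum f I) = (\<Sum>x\<in>I. subst h (f x))"
  by (induction I rule: infinite_finite_induct) (auto simp: subst_add)

lemma subst_single:
  "subst h (Poly_Mapping.single m c) = Const c * (\<Prod>i\<in>keys m. h i ^ lookup m i)"
  by (subst subst_superset[of "{m}"]) auto

text \<open>This is how the action on a direct sum is compared with the action on one summand, for
  polynomials in the variables of that summand.\<close>

lemma subst_cong:
  assumes "f \<in> carrier (poly_ring A)" "\<And>i. i \<in> A \<Longrightarrow> h i = h' i"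
  shows "subst h f = subst h' f"
  unfolding subst_def
proof (intro sum.cong refl arg_cong2[where f="(*)"] prod.cong)
  fix m i assume "m \<in> keys f" "i \<in> keys m"
  then have "i \<in> A" using assms(1) by (auto simp: carrier_poly_ring mono_span_def)
  then show "h i ^ lookup m i = h' i ^ lookup m i" by (simp add: assms(2))
qed

lemma subst_single_carrier:
  assumes "\<And>i. i \<in> keys m \<Longrightarrow> h i \<in> carrier (poly_ring B)"
  shows "subst h (Poly_Mapping.single m c) \<in> carrier (poly_ring B)"
  unfolding subst_single using assms
  by (intro carrier_closed prod_carrier Const_carrier) auto

lemma subst_single_add:
  "subst h (Poly_Mapping.single (m + n) c) =
    subst h (Poly_Mapping.single m c) * (\<Prod>i\<in>keys n. h i ^ lookup n i)"
proof -
  let ?K = "keys m \<union> keys n"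
  have "(\<Prod>i\<in>keys (m + n). h i ^ lookup (m + n) i) = (\<Prod>i\<in>?K. h i ^ lookup m i * h i ^ lookup n i)"
    by (simp add: keys_add_subset lookup_add power_add)
  also have "\<dots> = (\<Prod>i\<in>keys m. h i ^ lookup m i) * (\<Prod>i\<in>keys n. h i ^ lookup n i)"
    unfolding prod.distrib
    by (intro arg_cong2[where f="(*)"] prod.mono_neutral_right) (auto simp: in_keys_iff)
  finally show ?thesis by (simp add: subst_single algebra_simps)
qed

lemma prod_Var: "(\<Prod>i\<in>keys n. Var i ^ lookup n i) = Poly_Mapping.single n 1"
proof -
  have "(\<Prod>i\<in>K. Var i ^ lookup n i) =
      Poly_Mapping.single (\<Sum>i\<in>K. Poly_Mapping.single i (lookup n i)) (1 :: 'b)" if "finite K" for K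
    using that by induction (auto simp: Var_power mult_single)
  from this[OF finite_keys, of n] show ?thesis by (simp add: sum_singles)
qed

lemma monomial_split:
  fixes m :: "'i \<Rightarrow>\<^sub>0 nat"
  assumes "keys m \<subseteq> B \<union> C" "B \<inter> C = {}"
  obtains n q where "m = n + q" "keys n \<subseteq> B" "keys q \<subseteq> C"
proof -
  \<comment> \<open>\<open>?s K\<close> is the part of \<open>m\<close> in the variables of
    \<open>K\<close>.\<close>
  let ?s = "\<lambda>K. \<Sum>i\<in>K. Poly_Mapping.single i (lookup m i)"
  have "keys m = (keys m \<inter> B) \<union> (keys m \<inter> C)" using assms by auto
  then have "?s (keys m) = ?s (keys m \<inter> B) + ?s (keys m \<inter> C)"
    using assms by (subst sum.union_disjoint[symmetric]) auto
  moreover have "keys (?s (keys m \<inter> D)) \<subseteq> D" for D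
    using Poly_Mapping.keys_sum[of "\<lambda>i. Poly_Mapping.single i (lookup m i)" "keys m \<inter> D"] by (auto split: if_splits)
  ultimately show thesis using that by (metis sum_singles)
qed

text \<open>
  The coefficient of the monomial \<open>q\<close> in a polynomial over \<open>k[B]\<close>; this reading is only
  correct when the variables of \<open>q\<close> lie outside \<open>B\<close>.
\<close>

lift_definition slice :: "'i set \<Rightarrow> ('i \<Rightarrow>\<^sub>0 nat) \<Rightarrow> ('i, 'k::field) mpoly \<Rightarrow> ('i, 'k) mpoly" is
  "\<lambda>B q f n. if keys n \<subseteq> B then f (n + q) else 0"
proof -
  fix B :: "'i set" and q :: "'i \<Rightarrow>\<^sub>0 nat" and f :: "('i \<Rightarrow>\<^sub>0 nat) \<Rightarrow> 'k"
  assume "finite {m. f m \<noteq> 0}"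
  then have "finite ((\<lambda>n. n + q) -` {m. f m \<noteq> 0})"
    by (rule finite_vimageI) (simp add: inj_on_def)
  then show "finite {n. (if keys n \<subseteq> B then f (n + q) else 0) \<noteq> 0}"
    by (rule rev_finite_subset) auto
qed

lemma slice_add: "slice B q (f + g) = slice B q f + slice B q g"
  by (rule poly_mapping_eqI) (simp add: slice.rep_eq lookup_add)

lemma slice_0 [simp]: "slice B q 0 = 0"
  by (rule poly_mapping_eqI) (simp add: slice.rep_eq)

lemma slice_sum: "slice B q (sum f I) = (\<Sum>x\<in>I. slice B q (f x))"
  by (induction I rule: infinite_finite_induct) (auto simp: slice_add)

lemma slice_carrier: "slice B q f \<in> carrier (poly_ring B)"
proof -
  have "keys n \<subseteq> B" if "n \<in> keys (slice B q f)" for n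
    using that by (simp add: in_keys_iff slice.rep_eq split: if_splits)
  then show ?thesis by (auto simp: carrier_poly_ring mono_span_def)
qed

lemma slice_eq_0:
  assumes "f \<in> mono_span U" "\<And>n. keys n \<subseteq> B \<Longrightarrow> n + q \<notin> U"
  shows "slice B q f = 0"
  using assms by (intro poly_mapping_eqI) (auto simp: slice.rep_eq mono_span_def in_keys_iff)

lemma slice_single:
  assumes "keys n \<subseteq> B" "keys q \<inter> B = {}" "keys q' \<inter> B = {}"
  shows "slice B q (Poly_Mapping.single (n + q') c) = (if q' = q then Poly_Mapping.single n c else 0)"
proof (rule poly_mapping_eqI)
  fix k
  \<comment> \<open>A monomial factors uniquely into a part over \<open>B\<close> and a part off
    \<open>B\<close>: at each variable one of the two exponents is 0.\<close>
  have "k = n \<and> q = q'" if "keys k \<subseteq> B" "k + q = n + q'"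
  proof -
    have "lookup k i = lookup n i \<and> lookup q i = lookup q' i" for i
    proof (cases "i \<in> B")
      case True
      then have "lookup q i = 0" "lookup q' i = 0"
        using assms by (auto simp flip: not_in_keys_iff_lookup_eq_zero)
      then show ?thesis
        using arg_cong[OF that(2), of "\<lambda>m. lookup m i"] by (simp add: lookup_add)
    next
      case False
      then have "lookup k i = 0" "lookup n i = 0"
        using assms that by (auto simp flip: not_in_keys_iff_lookup_eq_zero)
      then show ?thesis
        using arg_cong[OF that(2), of "\<lambda>m. lookup m i"] by (simp add: lookup_add)
    qed
    then show ?thesis by (auto intro: poly_mapping_eqI)
  qed
  then show "lookup (slice B q (Poly_Mapping.single (n + q') c)) k =
      lookup (if q' = q then Poly_Mapping.single n c else 0) k"
    using assms by (auto simp: slice.rep_eq lookup_single when_def)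
qed

lemma slice_mult_single:
  assumes g: "g \<in> carrier (poly_ring B)" and "keys q \<inter> B = {}" "keys q' \<inter> B = {}"
  shows "slice B q (g * Poly_Mapping.single q' 1) = (if q' = q then g else 0)"
proof -
  have "g * Poly_Mapping.single q' 1 = (\<Sum>n\<in>keys g. Poly_Mapping.single (n + q') (lookup g n))"
    by (subst (1) sum_singles[of g, symmetric]) (simp add: sum_distrib_right mult_single)
  then have "slice B q (g * Poly_Mapping.single q' 1) =
      (\<Sum>n\<in>keys g. slice B q (Poly_Mapping.single (n + q') (lookup g n)))"
    by (simp only: slice_sum)
  also have "\<dots> = (\<Sum>n\<in>keys g. if q' = q then Poly_Mapping.single n (lookup g n) else 0)"
    using assms by (intro sum.cong refl slice_single) (auto simp: carrier_poly_ring mono_span_def)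
  finally have *: "slice B q (g * Poly_Mapping.single q' 1) = \<dots>" .
  show ?thesis unfolding * by (simp add: sum_singles)
qed

text \<open>Work modulo the ideal generated by the variables of \<open>V\<close>. There
  \<open>h\<close> kills \<open>V\<close>, fixes \<open>W\<close> and maps polynomials over
  \<open>B\<close> to polynomials over \<open>B\<close>. A monomial n q' with n over
  \<open>B\<close> and q' over \<open>W\<close> is therefore sent to h(n) q', whose coefficient at
  \<open>q\<close> is h(n) if q' = q and 0 otherwise.\<close>

lemma slice_subst:
  fixes f :: "('i, 'k::field) mpoly"
  assumes disj: "B \<inter> V = {}" "B \<inter> W = {}" "V \<inter> W = {}"
    and B: "\<And>i. i \<in> B \<Longrightarrow> h i \<in> carrier (poly_ring B)"
    and V: "\<And>i. i \<in> V \<Longrightarrow> h i \<in> mono_span {m. keys m \<inter> V \<noteq> {}}"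
    and W: "\<And>i. i \<in> W \<Longrightarrow> h i - Var i \<in> mono_span {m. keys m \<inter> V \<noteq> {}}"
    and f: "f \<in> carrier (poly_ring (B \<union> V \<union> W))" and q: "keys q \<subseteq> W"
  shows "slice B q (subst h f) = subst h (slice B q f)"
proof -
  let ?U = "{m :: 'i \<Rightarrow>\<^sub>0 nat. keys m \<inter> V \<noteq> {}}"
  have up: "upward ?U" by (auto simp: upward_def keys_add_subset)
  \<comment> \<open>Only monomials over \<open>B\<close> and \<open>W\<close> enter the slice, and
    those in the ideal involve \<open>V\<close>.\<close>
  have kill: "slice B q g = 0" if "g \<in> mono_span ?U" for g :: "('i, 'k) mpoly"
    using that q disj by (intro slice_eq_0[of _ ?U]) (auto simp: keys_add_subset)
  have "slice B q (subst h (Poly_Mapping.single m c)) = subst h (slice B q (Poly_Mapping.single m c))"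
    if m: "keys m \<subseteq> B \<union> V \<union> W" for m c
  proof (cases "keys m \<inter> V = {}")
    \<comment> \<open>The monomial and its image both lie in the ideal, since a variable of
      \<open>V\<close> occurs with positive exponent; both sides are 0.\<close>
    case False
    then obtain x where x: "x \<in> keys m" "x \<in> V" by auto
    have "h x ^ lookup m x \<in> mono_span ?U"
      using x mono_span_mult[OF up V[OF x(2)]] by (cases "lookup m x") (simp_all add: in_keys_iff)
    then have "subst h (Poly_Mapping.single m c) \<in> mono_span ?U"
      unfolding subst_single prod.remove[OF finite_keys x(1)]
      by (intro mono_span_mult'[OF up] mono_span_mult[OF up])
    moreover have "Poly_Mapping.single m c \<in> mono_span ?U"
      using False by (simp add: mono_span_single)
    ultimately show ?thesis by (simp add: kill)
  next
    case True
    then obtain n q' where nq: "m = n + q'" "keys n \<subseteq> B" "keys q' \<subseteq> W"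
      using monomial_split[of m B W] m disj by blast
    let ?g = "subst h (Poly_Mapping.single n c)"
    have g: "?g \<in> carrier (poly_ring B)"
      using nq B by (intro subst_single_carrier) auto
    \<comment> \<open>The error made by treating the variables of \<open>W\<close> as fixed. It lies
      in the ideal because congruences pass to powers and products.\<close>
    define r where "r = (\<Prod>i\<in>keys q'. h i ^ lookup q' i) - Poly_Mapping.single q' 1"
    have "r \<in> mono_span ?U"
      unfolding r_def prod_Var[symmetric]
      using nq W by (intro mono_span_prod_cong[OF up] mono_span_power_cong[OF up]) auto
    then have "slice B q (?g * r) = 0" by (intro kill mono_span_mult'[OF up])
    moreover have "subst h (Poly_Mapping.single m c) = ?g * Poly_Mapping.single q' 1 + ?g * r"
      by (simp add: nq subst_single_add r_def algebra_simps)
    moreover have "keys q \<inter> B = {}" "keys q' \<inter> B = {}" using q nq disj by auto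
    ultimately show ?thesis
      using g nq by (simp add: slice_add slice_mult_single slice_single)
  qed
  then have *: "(\<Sum>m\<in>keys f. slice B q (subst h (Poly_Mapping.single m (lookup f m)))) =
      (\<Sum>m\<in>keys f. subst h (slice B q (Poly_Mapping.single m (lookup f m))))"
    using f by (intro sum.cong) (auto simp: carrier_poly_ring mono_span_def)
  have "slice B q (subst h (\<Sum>m\<in>keys f. Poly_Mapping.single m (lookup f m))) =
      subst h (slice B q (\<Sum>m\<in>keys f. Poly_Mapping.single m (lookup f m)))"
    by (simp only: subst_sum slice_sum *)
  then show ?thesis by (simp only: sum_singles)
qed

lemma mdegree_add:
  fixes m n :: "'i \<Rightarrow>\<^sub>0 nat"
  shows "sum (lookup (m + n)) (keys (m + n)) = sum (lookup m) (keys m) + sum (lookup n) (keys n)"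
proof -
  let ?K = "keys m \<union> keys n"
  have "sum (lookup (m + n)) (keys (m + n)) = sum (lookup m) ?K + sum (lookup n) ?K"
    by (simp add: keys_add_subset lookup_add sum.distrib)
  also have "\<dots> = sum (lookup m) (keys m) + sum (lookup n) (keys n)"
    by (intro arg_cong2[where f="(+)"] sum.mono_neutral_right) (auto simp: in_keys_iff)
  finally show ?thesis .
qed

lemma mdegree_pos: "m \<noteq> 0 \<Longrightarrow> sum (lookup m) (keys m) > (0 :: nat)"
  by (auto simp: in_keys_iff intro!: sum_pos)

text \<open>The degree is expressed through \<open>n\<close> rather than as \<open>d\<close> minus
  the degree of \<open>q\<close>, so that it is visibly positive when \<open>n\<close> is not
  0.\<close>

lemma slice_homogeneous:
  assumes "homogeneous d f" "n + q \<in> keys f"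
  shows "homogeneous (sum (lookup n) (keys n)) (slice B q f)"
  unfolding homogeneous_def
proof
  fix k assume "k \<in> keys (slice B q f)"
  then have "k + q \<in> keys f" by (auto simp: in_keys_iff slice.rep_eq split: if_splits)
  then show "sum (lookup k) (keys k) = sum (lookup n) (keys n)"
    using assms unfolding homogeneous_def by (metis mdegree_add add_right_cancel)
qed

section \<open>Linear forms on a module and on a direct sum\<close>

lemma linear_form_carrier: "linear_form A b l \<in> carrier (poly_ring A)"
  unfolding linear_form_def carrier_poly_ring
  by (intro mono_span_sum) (simp add: carrier_closed Const_carrier Var_carrier flip: carrier_poly_ring)

text \<open>Coordinates are unique by independence. \<open>dual.representation\<close> is indexed by
  basis vectors, and injectivity of \<open>b\<close> carries it over to the index set
  \<open>A\<close>.\<close>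

lemma linear_form_sum:
  assumes "dual_basis smul A b"
  shows "linear_form A b (\<Sum>i\<in>A. dual_scale (c i) (b i)) = (\<Sum>i\<in>A. Const (c i) * Var i)"
proof -
  have fin: "finite A" and inj: "inj_on b A" and ind: "dual.independent (b ` A)"
    using assms by (auto simp: dual_basis_def)
  have "dual.representation (b ` A) (\<Sum>i\<in>A. dual_scale (c i) (b i)) (b j) = c j"
    if j: "j \<in> A" for j
  proof -
    have "dual.representation (b ` A) (\<Sum>i\<in>A. dual_scale (c i) (b i)) (b j) =
        (\<Sum>i\<in>A. dual.representation (b ` A) (dual_scale (c i) (b i)) (b j))"
      by (subst dual.representation_sum[OF ind]) (auto intro: dual.span_scale dual.span_base)
    also have "\<dots> = (\<Sum>i\<in>A. if i = j then c i else 0)"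
    proof (rule sum.cong[OF refl])
      fix i assume i: "i \<in> A"
      then have "b j = b i \<longleftrightarrow> i = j" using inj j by (auto dest: inj_onD)
      then show "dual.representation (b ` A) (dual_scale (c i) (b i)) (b j) = (if i = j then c i else 0)"
        using i by (simp add: dual.representation_scale[OF ind] dual.span_base
            dual.representation_basis[OF ind])
    qed
    also have "\<dots> = c j" using fin j by simp
    finally show ?thesis .
  qed
  then show ?thesis by (simp add: linear_form_def)
qed

lemma dual_basis_expand:
  assumes "dual_basis smul A b" "l \<in> dual_space smul"
  shows "l = (\<Sum>i\<in>A. dual_scale (dual.representation (b ` A) l (b i)) (b i))"
proof -
  have "finite A" and inj: "inj_on b A" and ind: "dual.independent (b ` A)"
    and span: "l \<in> dual.span (b ` A)"
    using assms by (auto simp: dual_basis_def)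
  then have "(\<Sum>x\<in>b ` A. dual_scale (dual.representation (b ` A) l x) x) = l"
    by (intro dual.sum_representation_eq) auto
  then show ?thesis using inj by (simp add: sum.reindex)
qed

lemma dual_basis_in_dual_space:
  "dual_basis smul A b \<Longrightarrow> i \<in> A \<Longrightarrow> b i \<in> dual_space smul"
  using dual.span_base[of "b i" "b ` A"] by (auto simp: dual_basis_def)

lemma linear_form_basis:
  assumes "dual_basis smul A b" "i \<in> A"
  shows "linear_form A b (b i) = Var i"
proof -
  have "finite A" using assms by (simp add: dual_basis_def)
  have "b i = (\<Sum>j\<in>A. dual_scale (if j = i then 1 else 0) (b j))"
  proof -
    have "(\<Sum>j\<in>A. dual_scale (if j = i then 1 else 0) (b j)) = (\<Sum>j\<in>A. if j = i then b j else 0)"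
      by (intro sum.cong) auto
    then show ?thesis using assms(2) \<open>finite A\<close> by simp
  qed
  then have "linear_form A b (b i) = (\<Sum>j\<in>A. Const (if j = i then 1 else 0) * Var j)"
    using linear_form_sum[OF assms(1), of "\<lambda>j. if j = i then 1 else 0"] by simp
  also have "\<dots> = (\<Sum>j\<in>A. if j = i then Var j else 0)"
    by (intro sum.cong) (auto simp: Const_def)
  finally show ?thesis using assms(2) \<open>finite A\<close> by simp
qed

text \<open>Applied with \<open>fst\<close> and \<open>snd\<close> as \<open>g\<close>, this says
  that extending a functional on a summand by zero does not change its linear polynomial.\<close>

lemma linear_form_pullback:
  assumes l: "l \<in> dual_space smul'" and B: "dual_basis smul' B b'"
    and A: "dual_basis smul A b" "B \<subseteq> A" and pull: "\<And>i. i \<in> B \<Longrightarrow> b i = b' i \<circ> g"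
  shows "linear_form A b (l \<circ> g) = linear_form B b' l"
proof -
  \<comment> \<open>The coordinates over \<open>B\<close>, extended by 0 to
    \<open>A\<close>.\<close>
  define c where "c = (\<lambda>i. if i \<in> B then dual.representation (b' ` B) l (b' i) else 0)"
  have fin: "finite A" using A by (simp add: dual_basis_def)
  have comp_sum: "sum f I \<circ> g = (\<Sum>i\<in>I. f i \<circ> g)" for f I
    by (induction I rule: infinite_finite_induct) (auto simp: fun_eq_iff)
  have "l \<circ> g = (\<Sum>i\<in>B. dual_scale (c i) (b' i)) \<circ> g"
    using dual_basis_expand[OF B l] by (simp add: c_def)
  also have "\<dots> = (\<Sum>i\<in>B. dual_scale (c i) (b i))"
    unfolding comp_sum by (intro sum.cong) (auto simp: pull dual_scale_def)
  also have "\<dots> = (\<Sum>i\<in>A. dual_scale (c i) (b i))"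
    using fin A(2) by (intro sum.mono_neutral_left) (auto simp: c_def)
  finally have "linear_form A b (l \<circ> g) = (\<Sum>i\<in>A. Const (c i) * Var i)"
    by (simp only: linear_form_sum[OF A(1)])
  also have "\<dots> = (\<Sum>i\<in>B. Const (c i) * Var i)"
    using fin A(2) by (intro sum.mono_neutral_right) (auto simp: c_def Const_0)
  finally show ?thesis by (simp add: linear_form_def c_def)
qed

lemma dual_act_in_dual_space:
  assumes "kG_module G smul act" "\<sigma> \<in> carrier G" "l \<in> dual_space smul"
  shows "dual_act G act \<sigma> l \<in> dual_space smul"
proof -
  interpret kG_module G smul act by fact
  interpret Vector_Spaces.linear smul smul "act (inv\<^bsub>G\<^esub> \<sigma>)"
    using assms group.inv_closed[OF group_hom.axioms(1)[OF group_hom]] by (intro linear_act)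
  show ?thesis
    using assms(3) unfolding dual_space_iff[OF vector_space_axioms]
    by (simp add: dual_act_def add scale)
qed

section \<open>The action of a p-group on terminal variables\<close>

lemma dual_act_add: "dual_act G act \<sigma> (f + g) = dual_act G act \<sigma> f + dual_act G act \<sigma> g"
  by (simp add: dual_act_def fun_eq_iff)

lemma dual_act_scale: "dual_act G act \<sigma> (dual_scale c f) = dual_scale c (dual_act G act \<sigma> f)"
  by (simp add: dual_act_def dual_scale_def fun_eq_iff)

lemma dual_act_one:
  assumes "kG_module G smul act" shows "dual_act G act \<one>\<^bsub>G\<^esub> f = f"
proof -
  interpret kG_module G smul act by fact
  interpret group G by (rule group_hom.axioms(1)[OF group_hom])
  have "act \<one>\<^bsub>G\<^esub> = (\<lambda>v. v)" using id_eq_one by (auto simp: fun_eq_iff restrict_def)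
  then show ?thesis by (simp add: dual_act_def comp_def)
qed

lemma dual_act_mult:
  assumes "kG_module G smul act" "\<sigma> \<in> carrier G" "\<tau> \<in> carrier G"
  shows "dual_act G act (\<sigma> \<otimes>\<^bsub>G\<^esub> \<tau>) f = dual_act G act \<sigma> (dual_act G act \<tau> f)"
proof -
  interpret kG_module G smul act by fact
  interpret group G by (rule group_hom.axioms(1)[OF group_hom])
  show ?thesis
    using assms by (simp add: dual_act_def fun_eq_iff inv_mult_group composition_rule)
qed

lemma representation_span_subset:
  assumes "dual_basis smul A b" "y \<in> A" "l \<in> dual.span (b ` (A - {y}))"
  shows "dual.representation (b ` A) l (b y) = 0"
proof -
  have ind: "dual.independent (b ` A)" and inj: "inj_on b A"
    using assms by (auto simp: dual_basis_def)
  have "dual.representation (b ` A) l = dual.representation (b ` (A - {y})) l"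
    using assms by (intro dual.representation_extend ind) auto
  moreover have "b y \<notin> b ` (A - {y})" using inj assms(2) by (auto dest: inj_onD)
  ultimately show ?thesis using dual.representation_ne_zero by metis
qed

text \<open>By additivity of Frobenius, (c - 1)^(p^r) = c^(p^r) - 1 = 0, and a field has no nonzero
  nilpotent elements.\<close>

lemma power_prime_power_eq_1:
  fixes c :: "'k::field"
  assumes "prime p" "CHAR('k) = p" "c ^ (p ^ r) = 1"
  shows "c = 1"
proof -
  have "((c - 1) + 1) ^ (p ^ r) = (c - 1) ^ (p ^ r) + 1 ^ (p ^ r)"
    using assms by (intro freshmans_dream') auto
  then have "(c - 1) ^ (p ^ r) = 0" using assms by simp
  then show ?thesis by simp
qed

text \<open>
  The diagonal coefficients form a character of the p-group, since the span of the other basis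
  elements is stable; in characteristic p such a character is trivial.
\<close>

lemma terminal_variable_diagonal:
  fixes b :: "'i \<Rightarrow> 'v::ab_group_add \<Rightarrow> 'k::field"
  assumes p: "prime p" "CHAR('k) = p" "finite (carrier G)" "order G = p ^ r"
    and M: "kG_module G smul act" and A: "dual_basis smul A b"
    and y: "terminal_variable G smul act A b y" and s: "\<sigma> \<in> carrier G"
  shows "dual.representation (b ` A) (dual_act G act \<sigma> (b y)) (b y) = 1"
proof -
  interpret kG_module G smul act by fact
  interpret group G by (rule group_hom.axioms(1)[OF group_hom])
  define U where "U = dual.span (b ` (A - {y}))"
  have yA: "y \<in> A" and U: "dual_submodule G smul act U"
    using y by (auto simp: terminal_variable_def U_def)
  have stable: "dual_act G act \<tau> u \<in> U" if "\<tau> \<in> carrier G" "u \<in> U" for \<tau> u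
    using U that by (auto simp: dual_submodule_def)
  have subsp: "dual.subspace U" by (simp add: U_def)
  have fin: "finite A" using A by (simp add: dual_basis_def)
  define c where "c = dual.representation (b ` A) (dual_act G act \<sigma> (b y)) (b y)"
  have "dual_act G act \<sigma> (b y) =
      (\<Sum>i\<in>A. dual_scale (dual.representation (b ` A) (dual_act G act \<sigma> (b y)) (b i)) (b i))"
    by (rule dual_basis_expand[OF A dual_act_in_dual_space[OF M s dual_basis_in_dual_space[OF A yA]]])
  also have "\<dots> = dual_scale c (b y) + (\<Sum>i\<in>A - {y}.
      dual_scale (dual.representation (b ` A) (dual_act G act \<sigma> (b y)) (b i)) (b i))"
    unfolding c_def by (rule sum.remove[OF fin yA])
  finally obtain u where u: "u \<in> U" "dual_act G act \<sigma> (b y) = dual_scale c (b y) + u"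
    unfolding U_def by (metis (no_types, lifting) dual.span_sum dual.span_scale dual.span_base imageI)
  \<comment> \<open>Modulo the stable subspace \<open>U\<close>, \<sigma> multiplies
    \<open>b y\<close> by \<open>c\<close>, so its n-th power multiplies \<open>b y\<close> by
    \<open>c ^ n\<close>.\<close>
  have "\<exists>u\<in>U. dual_act G act (\<sigma> [^]\<^bsub>G\<^esub> n) (b y) = dual_scale (c ^ n) (b y) + u" for n :: nat
  proof (induction n)
    case 0
    then show ?case
      using dual.subspace_0[OF subsp] by (intro bexI[of _ 0]) (simp_all add: dual_act_one[OF M])
  next
    case (Suc n)
    then obtain v where v: "v \<in> U"
      "dual_act G act (\<sigma> [^]\<^bsub>G\<^esub> n) (b y) = dual_scale (c ^ n) (b y) + v" by blast
    have "dual_act G act (\<sigma> [^]\<^bsub>G\<^esub> Suc n) (b y) =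
        dual_scale (c ^ Suc n) (b y) + (dual_scale c v + dual_act G act (\<sigma> [^]\<^bsub>G\<^esub> n) u)"
      using s by (simp add: dual_act_mult[OF M] u v dual_act_add dual_act_scale
          dual.scale_right_distrib add.assoc)
    moreover have "dual_scale c v + dual_act G act (\<sigma> [^]\<^bsub>G\<^esub> n) u \<in> U"
      by (intro dual.subspace_add[OF subsp] dual.subspace_scale[OF subsp] v stable nat_pow_closed s u)
    ultimately show ?case by blast
  qed
  \<comment> \<open>The power of \<sigma> with exponent \<open>order G\<close> is the identity;
    comparing coordinates at \<open>b y\<close> gives \<open>c ^ order G = 1\<close>.\<close>
  from this[of "order G"] obtain v where v: "v \<in> U" "dual_scale (c ^ order G) (b y) + v = b y"
    unfolding pow_order_eq_1[OF s] dual_act_one[OF M] by metis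
  have ind: "dual.independent (b ` A)" and span: "v \<in> dual.span (b ` A)" "b y \<in> dual.span (b ` A)"
    using A yA v(1) dual.span_mono[of "b ` (A - {y})" "b ` A"]
    by (auto simp: dual_basis_def U_def intro: dual.span_base)
  have "1 = dual.representation (b ` A) (b y) (b y)"
    using yA by (simp add: dual.representation_basis[OF ind])
  also have "\<dots> = dual.representation (b ` A) (dual_scale (c ^ order G) (b y) + v) (b y)"
    by (simp only: v(2))
  also have "\<dots> = c ^ order G"
    using yA v(1) representation_span_subset[OF A yA, of v] span
    by (simp add: dual.representation_add[OF ind] dual.span_scale dual.representation_scale[OF ind]
        dual.representation_basis[OF ind] U_def)
  finally have "c ^ (p ^ r) = 1" using p by simp
  then show ?thesis using power_prime_power_eq_1 p c_def by blast
qed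

lemma Var_mono_span: "i \<in> V \<Longrightarrow> Var i \<in> mono_span {m. keys m \<inter> V \<noteq> {}}"
  by (simp add: Var_def mono_span_def)

text \<open>The coefficient of \<open>y\<close> itself is 1 and cancels. Any other index outside
  \<open>V\<close> is terminal and has coefficient 0, so that only variables of \<open>V\<close>
  remain.\<close>

lemma linear_form_terminal:
  fixes b :: "'i \<Rightarrow> 'v::ab_group_add \<Rightarrow> 'k::field"
  assumes p: "prime p" "CHAR('k) = p" "finite (carrier G)" "order G = p ^ r"
    and M: "kG_module G smul act" and A: "dual_basis smul A b" "A = V \<union> W"
    and tv: "\<And>i. i \<in> W \<Longrightarrow> terminal_variable G smul act A b i"
    and s: "\<sigma> \<in> carrier G" and y: "y \<in> W"
  shows "linear_form A b (dual_act G act \<sigma> (b y)) - Var y \<in> mono_span {m. keys m \<inter> V \<noteq> {}}"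
proof -
  let ?c = "\<lambda>i. dual.representation (b ` A) (dual_act G act \<sigma> (b y)) (b i)"
  have fin: "finite A" using A by (simp add: dual_basis_def)
  have "linear_form A b (dual_act G act \<sigma> (b y)) =
      Const (?c y) * Var y + (\<Sum>i\<in>A - {y}. Const (?c i) * Var i)"
    unfolding linear_form_def using A y by (intro sum.remove fin) auto
  moreover have "?c y = 1" by (rule terminal_variable_diagonal[OF p M A(1) tv[OF y] s])
  ultimately have "linear_form A b (dual_act G act \<sigma> (b y)) - Var y =
      (\<Sum>i\<in>A - {y}. Const (?c i) * Var i)"
    by (simp add: Const_def)
  also have "\<dots> \<in> mono_span {m. keys m \<inter> V \<noteq> {}}"
  proof (rule mono_span_sum)
    fix i assume i: "i \<in> A - {y}"
    show "Const (?c i) * Var i \<in> mono_span {m. keys m \<inter> V \<noteq> {}}"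
    proof (cases "i \<in> V")
      case True
      then show ?thesis
        by (intro mono_span_mult' Var_mono_span) (auto simp: upward_def keys_add_subset)
    next
      case False
      then have t: "terminal_variable G smul act A b i" using i A tv by auto
      \<comment> \<open>As \<open>i\<close> differs from \<open>y\<close>, the element
        \<open>b y\<close> lies in the span of the basis elements other than \<open>b i\<close>, and
        terminality of \<open>i\<close> makes this span stable.\<close>
      have "b y \<in> dual.span (b ` (A - {i}))" using A y i by (auto intro: dual.span_base)
      then have "dual_act G act \<sigma> (b y) \<in> dual.span (b ` (A - {i}))"
        using t s by (auto simp: terminal_variable_def dual_submodule_def)
      then have "?c i = 0" using i by (intro representation_span_subset[OF A(1)]) auto
      then show ?thesis by (simp add: Const_0 mono_span_0)
    qed
  qed
  finally show ?thesis .
qed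


section \<open>Hilbert ideals\<close>

lemma hilbert_ideal_generators_carrier:
  "{f \<in> invariant_polys G act A b. \<exists>d>0. homogeneous d f} \<subseteq> carrier (poly_ring A)"
  by (auto simp: invariant_polys_def)

text \<open>The two actions agree on the variables of \<open>B\<close>, hence on all polynomials in
  them. Invariants of a summand are thus invariants of the direct sum.\<close>

lemma invariant_polys_extend:
  assumes "B \<subseteq> A"
    and eq: "\<And>\<sigma> i. \<sigma> \<in> carrier G \<Longrightarrow> i \<in> B \<Longrightarrow>
      linear_form A b (dual_act G act \<sigma> (b i)) = linear_form B b' (dual_act G act' \<sigma> (b' i))"
  shows "invariant_polys G act' B b' \<subseteq> invariant_polys G act A b"
proof
  fix f assume f: "f \<in> invariant_polys G act' B b'"
  then have fB: "f \<in> carrier (poly_ring B)" by (simp add: invariant_polys_def)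
  have "poly_act G act A b \<sigma> f = poly_act G act' B b' \<sigma> f" if "\<sigma> \<in> carrier G" for \<sigma>
    unfolding poly_act_def by (rule subst_cong[OF fB eq[OF that]])
  then show "f \<in> invariant_polys G act A b"
    using f poly_ring_mono[OF assms(1)] by (auto simp: invariant_polys_def)
qed

lemma hilbert_ideal_extend:
  assumes "B \<subseteq> A"
    and "\<And>\<sigma> i. \<sigma> \<in> carrier G \<Longrightarrow> i \<in> B \<Longrightarrow>
      linear_form A b (dual_act G act \<sigma> (b i)) = linear_form B b' (dual_act G act' \<sigma> (b' i))"
  shows "hilbert_ideal G act' B b' \<subseteq> hilbert_ideal G act A b"
  unfolding hilbert_ideal_def
  using invariant_polys_extend[OF assms]
  by (intro Idl_poly_ring_mono assms hilbert_ideal_generators_carrier) auto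

text \<open>Taking the coefficient at \<open>q\<close> commutes with the action by
  \<open>slice_subst\<close>, so the coefficient is invariant; it is homogeneous of the degree of
  \<open>n\<close>, which is positive. The general partition of \<open>A\<close> covers two uses:
  coefficients over the first module, and, with \<open>q = 0\<close>, restriction to the
  second.\<close>

lemma slice_in_hilbert_ideal:
  assumes A: "A = B \<union> V \<union> W" "B \<inter> V = {}" "B \<inter> W = {}" "V \<inter> W = {}"
    and eq: "\<And>\<sigma> i. \<sigma> \<in> carrier G \<Longrightarrow> i \<in> B \<Longrightarrow>
      linear_form A b (dual_act G act \<sigma> (b i)) = linear_form B b' (dual_act G act' \<sigma> (b' i))"
    and V: "\<And>\<sigma> i. \<sigma> \<in> carrier G \<Longrightarrow> i \<in> V \<Longrightarrow>
      linear_form A b (dual_act G act \<sigma> (b i)) \<in> mono_span {m. keys m \<inter> V \<noteq> {}}"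
    and W: "\<And>\<sigma> i. \<sigma> \<in> carrier G \<Longrightarrow> i \<in> W \<Longrightarrow>
      linear_form A b (dual_act G act \<sigma> (b i)) - Var i \<in> mono_span {m. keys m \<inter> V \<noteq> {}}"
    and f: "f \<in> invariant_polys G act A b" "homogeneous d f"
    and n: "n + q \<in> keys f" "n \<noteq> 0" and q: "keys q \<subseteq> W"
  shows "slice B q f \<in> hilbert_ideal G act' B b'"
proof -
  have fA: "f \<in> carrier (poly_ring (B \<union> V \<union> W))"
    using f A by (simp add: invariant_polys_def)
  have "poly_act G act' B b' \<sigma> (slice B q f) = slice B q f" if s: "\<sigma> \<in> carrier G" for \<sigma>
  proof -
    let ?h = "\<lambda>i. linear_form A b (dual_act G act \<sigma> (b i))"
    have "poly_act G act' B b' \<sigma> (slice B q f) = subst ?h (slice B q f)"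
      unfolding poly_act_def by (rule subst_cong[OF slice_carrier eq[OF s, symmetric]])
    also have "\<dots> = slice B q (subst ?h f)"
    proof (rule slice_subst[OF A(2,3,4) _ V[OF s] W[OF s] fA q, symmetric])
      show "?h i \<in> carrier (poly_ring B)" if "i \<in> B" for i
        unfolding eq[OF s that] by (rule linear_form_carrier)
    qed
    also have "subst ?h f = f" using f(1) s by (simp add: invariant_polys_def poly_act_def)
    finally show ?thesis .
  qed
  then have "slice B q f \<in> invariant_polys G act' B b'"
    by (simp add: invariant_polys_def slice_carrier)
  moreover have "\<exists>d>0. homogeneous d (slice B q f)"
    using slice_homogeneous[OF f(2) n(1)] mdegree_pos[OF n(2)] by blast
  ultimately show ?thesis
    unfolding hilbert_ideal_def using Idl_poly_ring(2)[OF hilbert_ideal_generators_carrier] by blast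
qed

section \<open>The Hilbert ideal of a direct sum\<close>

text \<open>\<open>V\<close> and \<open>W\<close> are the fixed and the terminal variables of the
  second module. By \<open>Idl_powers\<close> the inclusion from left to right becomes a
  divisibility statement about the monomials of homogeneous invariants.\<close>

lemma hilbert_ideal_sum_powers:
  fixes b1 :: "'i \<Rightarrow> 'v::ab_group_add \<Rightarrow> 'k::field" and b2 :: "'i \<Rightarrow> 'w::ab_group_add \<Rightarrow> 'k"
  assumes p: "prime p" "CHAR('k) = p" "finite (carrier G)" "order G = p ^ r"
    and M: "kG_module G smul1 act1" "kG_module G smul2 act2"
    and A1: "dual_basis smul1 A1 b1" and A2: "dual_basis smul2 A2 b2" and disj: "A1 \<inter> A2 = {}"
    and VW: "A2 = V \<union> W" "V \<inter> W = {}"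
    and fixed: "\<And>i \<sigma>. i \<in> V \<Longrightarrow> \<sigma> \<in> carrier G \<Longrightarrow> dual_act G act2 \<sigma> (b2 i) = b2 i"
    and S1: "S1 \<subseteq> {Var i ^ e | i e. i \<in> A1}" and S2: "S2 \<subseteq> {Var i ^ e | i e. i \<in> A2}"
    and H1: "hilbert_ideal G act1 A1 b1 = Idl\<^bsub>poly_ring A1\<^esub> S1"
    and H2: "hilbert_ideal G act2 A2 b2 = Idl\<^bsub>poly_ring A2\<^esub> S2"
    and tv: "\<And>i. i \<in> W \<Longrightarrow> terminal_variable G smul2 act2 A2 b2 i"
  shows "hilbert_ideal G (sum_act act1 act2) (A1 \<union> A2) (sum_basis A1 b1 b2)
    = Idl\<^bsub>poly_ring (A1 \<union> A2)\<^esub> (S1 \<union> S2)"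
proof
  let ?act = "sum_act act1 act2" and ?A = "A1 \<union> A2" and ?b = "sum_basis A1 b1 b2"
  let ?h = "\<lambda>\<sigma> i. linear_form ?A ?b (dual_act G ?act \<sigma> (?b i))"
  note B = dual_basis_sum[OF M A1 A2 disj]
  have b1: "?b i = b1 i \<circ> fst" if "i \<in> A1" for i using that by (simp add: sum_basis_def)
  have b2: "?b i = b2 i \<circ> snd" if "i \<in> A2" for i using that disj by (auto simp: sum_basis_def)
  have h1: "?h \<sigma> i = linear_form A1 b1 (dual_act G act1 \<sigma> (b1 i))"
    if "\<sigma> \<in> carrier G" "i \<in> A1" for \<sigma> i
  proof -
    have "dual_act G ?act \<sigma> (?b i) = dual_act G act1 \<sigma> (b1 i) \<circ> fst"
      by (simp add: b1 that dual_act_def sum_act_def fun_eq_iff)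
    then show ?thesis
      using linear_form_pullback[OF dual_act_in_dual_space[OF M(1) that(1)
            dual_basis_in_dual_space[OF A1 that(2)]] A1 B, of fst] b1 by simp
  qed
  have h2: "?h \<sigma> i = linear_form A2 b2 (dual_act G act2 \<sigma> (b2 i))"
    if "\<sigma> \<in> carrier G" "i \<in> A2" for \<sigma> i
  proof -
    have "dual_act G ?act \<sigma> (?b i) = dual_act G act2 \<sigma> (b2 i) \<circ> snd"
      by (simp add: b2 that dual_act_def sum_act_def fun_eq_iff)
    then show ?thesis
      using linear_form_pullback[OF dual_act_in_dual_space[OF M(2) that(1)
            dual_basis_in_dual_space[OF A2 that(2)]] A2 B, of snd] b2 by simp
  qed
  have hV': "linear_form A2 b2 (dual_act G act2 \<sigma> (b2 i)) = Var i"
    if "\<sigma> \<in> carrier G" "i \<in> V" for \<sigma> i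
    using linear_form_basis[OF A2, of i] that VW by (simp add: fixed)
  have hV: "?h \<sigma> i = Var i" if "\<sigma> \<in> carrier G" "i \<in> V" for \<sigma> i
    using h2[OF that(1), of i] hV'[OF that] that VW by (metis UnI1)
  have S12: "S1 \<union> S2 \<subseteq> {Var i ^ e | i e. i \<in> ?A}" using S1 S2 by blast
  have carr: "S1 \<subseteq> carrier (poly_ring A1)" "S2 \<subseteq> carrier (poly_ring A2)"
    using S1 S2 by (auto simp: carrier_closed Var_carrier)
  show "Idl\<^bsub>poly_ring ?A\<^esub> (S1 \<union> S2) \<subseteq> hilbert_ideal G ?act ?A ?b"
  proof (rule Idl_subset_poly_ring)
    show "ideal (hilbert_ideal G ?act ?A ?b) (poly_ring ?A)"
      unfolding hilbert_ideal_def by (rule Idl_poly_ring(1)[OF hilbert_ideal_generators_carrier])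
    have "S1 \<subseteq> hilbert_ideal G act1 A1 b1" "S2 \<subseteq> hilbert_ideal G act2 A2 b2"
      unfolding H1 H2 using Idl_poly_ring(2) carr by auto
    moreover have "hilbert_ideal G act1 A1 b1 \<subseteq> hilbert_ideal G ?act ?A ?b"
      by (rule hilbert_ideal_extend[OF Un_upper1 h1])
    moreover have "hilbert_ideal G act2 A2 b2 \<subseteq> hilbert_ideal G ?act ?A ?b"
      by (rule hilbert_ideal_extend[OF Un_upper2 h2])
    ultimately show "S1 \<union> S2 \<subseteq> hilbert_ideal G ?act ?A ?b" by blast
  qed
  have pm: "power_multiples (S1 \<union> S2) = power_multiples S1 \<union> power_multiples S2"
    by (auto simp: power_multiples_def)
  \<comment> \<open>The fixed variable \<open>x\<close> is an invariant of degree 1 and so lies in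
    the Hilbert ideal of the second module. That ideal is generated by powers of variables, so an
    element of \<open>S2\<close> divides \<open>x\<close> and hence \<open>m\<close>.\<close>
  have V_in: "m \<in> power_multiples S2" if x: "x \<in> V" "x \<in> keys m" for x m
  proof -
    have "Var x \<in> {f \<in> invariant_polys G act2 A2 b2. \<exists>d>0. homogeneous d f}"
    proof -
      have "poly_act G act2 A2 b2 \<sigma> (Var x) = Var x" if "\<sigma> \<in> carrier G" for \<sigma>
        using hV'[OF that x(1)] by (simp add: poly_act_def Var_def[of x] subst_single Const_def)
      moreover have "homogeneous 1 (Var x :: ('i, 'k) mpoly)"
        by (simp add: homogeneous_def Var_def)
      ultimately show ?thesis
        using x VW by (auto simp: invariant_polys_def Var_carrier intro!: exI[of _ 1])
    qed
    then have "Var x \<in> hilbert_ideal G act2 A2 b2"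
      unfolding hilbert_ideal_def using Idl_poly_ring(2)[OF hilbert_ideal_generators_carrier] by blast
    then have "Poly_Mapping.single x 1 \<in> power_multiples S2"
      unfolding H2 Idl_powers[OF S2] by (simp add: mono_span_def Var_def)
    then have "Poly_Mapping.single x 1 + (m - Poly_Mapping.single x 1) \<in> power_multiples S2"
      using upward_power_multiples unfolding upward_def by blast
    moreover have "Poly_Mapping.single x 1 + (m - Poly_Mapping.single x 1) = m"
      using x(2) by (intro poly_mapping_eqI)
        (auto simp: lookup_add lookup_minus lookup_single when_def in_keys_iff)
    ultimately show ?thesis by (simp only:)
  qed
  have slice_key: "n \<in> keys (slice B q f)"
    if "n + q \<in> keys f" "keys n \<subseteq> B" for n q f and B :: "'i set"
    using that by (simp add: in_keys_iff slice.rep_eq)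
  have "m \<in> power_multiples (S1 \<union> S2)"
    if f: "f \<in> invariant_polys G ?act ?A ?b" "homogeneous d f" "d > 0" and m: "m \<in> keys f" for f d m
  proof (cases "keys m \<inter> V = {}")
    case False
    then show ?thesis using V_in pm by auto
  next
    case True
    have "keys m \<subseteq> ?A" using f(1) m by (auto simp: invariant_polys_def carrier_poly_ring mono_span_def)
    then obtain n q where nq: "m = n + q" "keys n \<subseteq> A1" "keys q \<subseteq> W"
      using monomial_split[of m A1 W] True VW disj by blast
    show ?thesis
    proof (cases "n = 0")
      case False
      \<comment> \<open>Here \<open>V\<close> is killed and \<open>W\<close> is fixed modulo
        \<open>V\<close>; the monomial \<open>n\<close> of the slice comes from
        \<open>m = n + q\<close> in \<open>f\<close>.\<close>
      have "slice A1 q f \<in> hilbert_ideal G act1 A1 b1"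
      proof (rule slice_in_hilbert_ideal[OF _ _ _ VW(2) h1 _ _ f(1,2) _ False nq(3)])
        show "?h \<sigma> i \<in> mono_span {m. keys m \<inter> V \<noteq> {}}" if "\<sigma> \<in> carrier G" "i \<in> V" for \<sigma> i
          using that by (simp add: hV Var_mono_span)
        show "?h \<sigma> i - Var i \<in> mono_span {m. keys m \<inter> V \<noteq> {}}" if "\<sigma> \<in> carrier G" "i \<in> W" for \<sigma> i
          using linear_form_terminal[OF p M(2) A2 VW(1) tv that] h2[OF that(1), of i] that VW by auto
      qed (use nq m VW disj in auto)
      then have "n \<in> power_multiples S1"
        using slice_key[of n q f A1] nq m unfolding H1 Idl_powers[OF S1] by (auto simp: mono_span_def)
      then show ?thesis using pm nq upward_power_multiples[of S1] by (auto simp: upward_def)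
    next
      case n: True
      then have m0: "m + 0 \<in> keys f" and mA2: "keys m \<subseteq> A2" using m nq VW by auto
      \<comment> \<open>A homogeneous polynomial of positive degree has no constant term.\<close>
      have "m \<noteq> 0" using f(2,3) m by (auto simp: homogeneous_def)
      \<comment> \<open>Now the variables of the first module are the killed ones: their span is
        stable, and setting them to 0 is restriction to the second module. The condition on
        \<open>W\<close> is vacuous.\<close>
      have "slice A2 0 f \<in> hilbert_ideal G act2 A2 b2"
      proof (rule slice_in_hilbert_ideal[where V = A1 and W = "{}", OF _ _ _ _ h2 _ _ f(1,2) m0 \<open>m \<noteq> 0\<close>])
        show "?h \<sigma> i \<in> mono_span {m. keys m \<inter> A1 \<noteq> {}}" if "\<sigma> \<in> carrier G" "i \<in> A1" for \<sigma> i
          unfolding h1[OF that] unfolding linear_form_def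
          by (intro mono_span_sum mono_span_mult' Var_mono_span) (auto simp: upward_def keys_add_subset)
      qed (use disj in auto)
      then have "m \<in> power_multiples S2"
        using slice_key[OF m0 mA2] unfolding H2 Idl_powers[OF S2] by (auto simp: mono_span_def)
      then show ?thesis using pm by simp
    qed
  qed
  then have "{f \<in> invariant_polys G ?act ?A ?b. \<exists>d>0. homogeneous d f} \<subseteq>
      carrier (poly_ring ?A) \<inter> mono_span (power_multiples (S1 \<union> S2))"
    by (auto simp: mono_span_def invariant_polys_def)
  moreover have "ideal (Idl\<^bsub>poly_ring ?A\<^esub> (S1 \<union> S2)) (poly_ring ?A)"
    using S12 by (intro Idl_poly_ring) (auto simp: carrier_closed Var_carrier)
  ultimately show "hilbert_ideal G ?act ?A ?b \<subseteq> Idl\<^bsub>poly_ring ?A\<^esub> (S1 \<union> S2)"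
    unfolding hilbert_ideal_def Idl_powers[OF S12, symmetric] by (intro Idl_subset_poly_ring)
qed

theorem theorem12:
  fixes p n1 m1 n2 m2 :: nat
    and G :: "('g, 'z) monoid_scheme"
    and smul1 :: "'k::field \<Rightarrow> 'v::ab_group_add \<Rightarrow> 'v" and act1 :: "'g \<Rightarrow> 'v \<Rightarrow> 'v"
    and smul2 :: "'k \<Rightarrow> 'w::ab_group_add \<Rightarrow> 'w" and act2 :: "'g \<Rightarrow> 'w \<Rightarrow> 'w"
    and b1 :: "var_index \<Rightarrow> 'v \<Rightarrow> 'k" and b2 :: "var_index \<Rightarrow> 'w \<Rightarrow> 'k"
    and S1 S2 :: "(var_index, 'k) mpoly set"
  assumes "prime p" and "CHAR('k) = p"
    and "group G" and "finite (carrier G)" and "\<exists>r. order G = p ^ r"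
    and "kG_module G smul1 act1"
    and "kG_module G smul2 act2"
    and "dual_basis smul1 (var_indices n1 m1 1) b1"
    and "dual_basis smul2 (var_indices n2 m2 2) b2"
    and "\<forall>i\<in>x_indices n1 1. \<forall>\<sigma>\<in>carrier G. dual_act G act1 \<sigma> (b1 i) = b1 i"
    and "\<forall>i\<in>x_indices n2 2. \<forall>\<sigma>\<in>carrier G. dual_act G act2 \<sigma> (b2 i) = b2 i"
    and "S1 \<subseteq> {Var i ^ e | i e. i \<in> var_indices n1 m1 1}"
    and "S2 \<subseteq> {Var i ^ e | i e. i \<in> var_indices n2 m2 2}"
    and "hilbert_ideal G act1 (var_indices n1 m1 1) b1 = Idl\<^bsub>poly_ring (var_indices n1 m1 1)\<^esub> S1"
    and "hilbert_ideal G act2 (var_indices n2 m2 2) b2 = Idl\<^bsub>poly_ring (var_indices n2 m2 2)\<^esub> S2"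
    and "\<forall>i\<in>y_indices m1 1. terminal_variable G smul1 act1 (var_indices n1 m1 1) b1 i"
    and "\<forall>i\<in>y_indices m2 2. terminal_variable G smul2 act2 (var_indices n2 m2 2) b2 i"
  shows "hilbert_ideal G (sum_act act1 act2) (var_indices n1 m1 1 \<union> var_indices n2 m2 2)
             (sum_basis (var_indices n1 m1 1) b1 b2)
           = Idl\<^bsub>poly_ring (var_indices n1 m1 1 \<union> var_indices n2 m2 2)\<^esub> (S1 \<union> S2)"
proof -
  obtain r where r: "order G = p ^ r" using assms(5) by blast
  show ?thesis
  proof (rule hilbert_ideal_sum_powers[OF assms(1,2,4) r assms(6-9),
        where V = "x_indices n2 2" and W = "y_indices m2 2"])
    \<comment> \<open>The second argument of an index separates the two modules, the constructors
      \<open>X\<close> and \<open>Y\<close> the two kinds of variables.\<close>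
    show "var_indices n1 m1 1 \<inter> var_indices n2 m2 2 = {}" "x_indices n2 2 \<inter> y_indices m2 2 = {}"
      by (auto simp: var_indices_def x_indices_def y_indices_def)
  qed (use assms(10-) in \<open>simp_all add: var_indices_def\<close>)
qed

end
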